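(* Let $\mathcal X$ be a Lévy process as described in the context, in one of the Cases A, B, C, and let $q>0$. If for some $\xi\in(0,1)$ and some constant $D>0$ one has $r^{-\xi}\Psi_{\mathcal S}(r)\to D$ as $r\downarrow0$, then, with $F_{I_{e_q}}(-u)=\mathbb P[I_{e_q}<-u]$, $$\lim_{u\to\infty}\frac{F_{I_{e_q}}(-u)}{u^{-\xi}}=\frac{D}{q\,\Gamma(1-\xi)} .$$
   Context: Process. $\mathcal X(t)=ct+\gamma\mathcal B(t)+\mathcal Z(t)-\mathcal S(t)$, $t\ge0$, with independent components: $c\ge0$, $\gamma\ge0$; $\mathcal B$ is a Brownian motion with variance parameter $2$ (so $\mathbb E[e^{r\gamma\mathcal B(1)}]=e^{\gamma^2r^2}$); $\mathcal Z$ is a compound Poisson process with Lévy measure $\lambda_1f_1(x)dx$, $\lambda_1>0$, where $f_1$ is a probability density on $(0,\infty)$ with Laplace transform $\widehat f_1(r)=Q(r)/\prod_{i=1}^N(\alpha_i+r)^{n_i}$, $0<\alpha_1<\dots<\alpha_N$ real, $n_i\in\mathbb N$, $n_1+\dots+n_N=m$, $Q$ a polynomial of degree at most $m-1$; $\mathcal S$ is a pure jump Lévy process with only positive jumps, Lévy measure $\nu_{\mathcal S}$ and Laplace exponent $\Psi_{\mathcal S}(r)=-\log\mathbb E[e^{-r\mathcal S(1)}]=\int_{0+}^\infty(1-e^{-rx}-rxh(x))\nu_{\mathcal S}(dx)$ ($h$ a truncation function). Cases. A: $c=\gamma=0$ and $\mathcal S$ is either a driftless subordinator that is not compound Poisson,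 or a compound Poisson process with $\mathbb E[\mathcal X(1)]>0$. B: $c>0$, $\gamma=0$, $\mathcal S$ a driftless subordinator. C: any other case except $c=\gamma=0$ with $\mathcal S$ compound Poisson and $\mathbb E[\mathcal X(1)]\le0$; in Case C it is assumed that $\int_{0+}^\infty(x^2\wedge x)\nu_{\mathcal S}(dx)<\infty$. When $\mathcal S$ is a driftless subordinator, $\Psi_{\mathcal S}(r)$ is $G_{\mathcal S}(r)=\int_{0+}^\infty(1-e^{-rx})\nu_{\mathcal S}(dx)$. Notation. $I_t=\inf_{0\le s\le t}\mathcal X(s)$; $e_q$ is an exponential random variable with parameter $q>0$ independent of $\mathcal X$; $\Gamma$ is the Gamma function. Known facts about this setting that may be used. Let $\Psi_{\mathcal X}(r)=cr+\gamma^2r^2+\lambda_1(Q(-r)/\prod_j(\alpha_j-r)^{n_j}-1)-\Psi_{\mathcal S}(r)$. For $q>0$ the equation $\Psi_{\mathcal X}(r)=q$ has in $\{\mathrm{Re}\,z>0\}$ finitely many distinct roots $\beta_1(q),\dots,\beta_R(q)$ with multiplicities $k_1,\dots,k_R$, where $\sum_jk_j=m$ in Case A and $m+1$ in Cases B, C; with $\kappa(q,r)=\prod_j(\beta_j(q)+r)^{k_j}/\prod_l(\alpha_l+r)^{n_l}$ and $S_{e_q}=\sup_{0\le s\le e_q}\mathcal X(s)$ one has $\mathbb E[e^{-rS_{e_q}}]=\kappa(q,0)/\kappa(q,r)$ for $r\ge0$ (Lewis and Mordecki). *)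

theory Defs
  imports "HOL-Probability.Probability" "HOL-Computational_Algebra.Polynomial"
begin

section \<open>Processes and independence\<close>

text \<open>Processes are indexed by \<^typ>\<open>real\<close>, but only the times \<open>t \<ge> 0\<close> matter.\<close>

definition process_events :: "'a measure \<Rightarrow> 't set \<Rightarrow> ('t \<Rightarrow> 'a \<Rightarrow> real) \<Rightarrow> 'a set set" where
  "process_events M T X =
     sigma_sets (space M) {X t -` A \<inter> space M | t A. t \<in> T \<and> A \<in> sets borel}"

definition indep_processes :: "'a measure \<Rightarrow> (real \<Rightarrow> 'a \<Rightarrow> real) list \<Rightarrow> bool" where
  "indep_processes M Xs \<longleftrightarrow>
     prob_space.indep_sets M (\<lambda>k. process_events M {0..} (Xs ! k)) {..<length Xs}"

definition cadlag :: "(real \<Rightarrow> real) \<Rightarrow> bool" where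
  "cadlag f \<longleftrightarrow> (\<forall>t\<ge>0. continuous (at_right t) f) \<and> (\<forall>t>0. \<exists>l. (f \<longlongrightarrow> l) (at_left t))"

text \<open>All paths, not only almost all, are cadlag: on a probability space that need not be
  complete this makes the running infimum finite and measurable.\<close>

definition levy_process :: "'a measure \<Rightarrow> (real \<Rightarrow> 'a \<Rightarrow> real) \<Rightarrow> bool" where
  "levy_process M X \<longleftrightarrow>
     (\<forall>t\<ge>0. X t \<in> borel_measurable M) \<and>
     (AE \<omega> in M. X 0 \<omega> = 0) \<and>
     (\<forall>(t :: nat \<Rightarrow> real) n. 0 \<le> t 0 \<and> (\<forall>i<n. t i \<le> t (Suc i)) \<longrightarrow>
        prob_space.indep_vars M (\<lambda>_. borel)
          (\<lambda>i \<omega>. X (t (Suc i)) \<omega> - X (t i) \<omega>) {..<n}) \<and>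
     (\<forall>s\<ge>0. \<forall>t\<ge>0. distr M borel (\<lambda>\<omega>. X (s + t) \<omega> - X s \<omega>) = distr M borel (X t)) \<and>
     (\<forall>\<omega>\<in>space M. cadlag (\<lambda>t. X t \<omega>))"

definition running_inf :: "(real \<Rightarrow> 'a \<Rightarrow> real) \<Rightarrow> real \<Rightarrow> 'a \<Rightarrow> real" where
  "running_inf X t \<omega> = (INF s\<in>{0..t}. X s \<omega>)"

definition laplace_exponent :: "'a measure \<Rightarrow> (real \<Rightarrow> 'a \<Rightarrow> real) \<Rightarrow> real \<Rightarrow> real" where
  "laplace_exponent M S r = - ln (\<integral>\<omega>. exp (- r * S 1 \<omega>) \<partial>M)"


section \<open>The components\<close>

text \<open>\<open>v\<close> is the variance at time 1.\<close>

definition brownian_motion :: "'a measure \<Rightarrow> real \<Rightarrow> (real \<Rightarrow> 'a \<Rightarrow> real) \<Rightarrow> bool" where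
  "brownian_motion M v B \<longleftrightarrow>
     levy_process M B \<and>
     (\<forall>t>0. distributed M lborel (B t) (normal_density 0 (sqrt (v * t)))) \<and>
     (\<forall>\<omega>\<in>space M. continuous_on {0..} (\<lambda>t. B t \<omega>))"

definition poisson_process :: "'a measure \<Rightarrow> real \<Rightarrow> (real \<Rightarrow> 'a \<Rightarrow> nat) \<Rightarrow> bool" where
  "poisson_process M l N \<longleftrightarrow>
     levy_process M (\<lambda>t \<omega>. real (N t \<omega>)) \<and>
     (\<forall>t\<ge>0. \<forall>k. measure M {\<omega>\<in>space M. N t \<omega> = k} = exp (- (l * t)) * (l * t) ^ k / fact k)"

text \<open>Compound Poisson process with Levy measure \<open>\<nu>\<close>: the sum of the first \<open>N t\<close> of the
  i.i.d. jumps \<open>J 0, J 1, \<dots>\<close>, where \<open>N\<close> has rate \<open>l\<close> and the jump law is \<open>\<nu> / l\<close>.\<close>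

definition compound_poisson :: "'a measure \<Rightarrow> real measure \<Rightarrow> (real \<Rightarrow> 'a \<Rightarrow> real) \<Rightarrow> bool" where
  "compound_poisson M \<nu> Z \<longleftrightarrow>
     levy_process M Z \<and> sets \<nu> = sets borel \<and> emeasure \<nu> {0} = 0 \<and>
     (\<exists>l N (J :: nat \<Rightarrow> 'a \<Rightarrow> real).
        l > 0 \<and> poisson_process M l N \<and>
        prob_space.indep_vars M (\<lambda>_. borel) J UNIV \<and>
        (\<forall>k. \<forall>A\<in>sets borel.
           emeasure \<nu> A = ennreal l * emeasure M {\<omega>\<in>space M. J k \<omega> \<in> A}) \<and>
        prob_space.indep_set M
          (process_events M {0..} (\<lambda>t \<omega>. real (N t \<omega>))) (process_events M UNIV J) \<and>
        (AE \<omega> in M. \<forall>t\<ge>0. Z t \<omega> = (\<Sum>i<N t \<omega>. J i \<omega>)))"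

definition positive_levy_measure :: "real measure \<Rightarrow> bool" where
  "positive_levy_measure \<nu> \<longleftrightarrow>
     sets \<nu> = sets borel \<and> emeasure \<nu> {..0} = 0 \<and> (\<integral>\<^sup>+x. ennreal (min 1 (x\<^sup>2)) \<partial>\<nu>) < \<infinity>"

text \<open>Besides genuine truncation functions (1 near the origin) the function 0 is allowed; it is
  the choice for a driftless subordinator, whose Laplace exponent has no compensating term.\<close>

definition truncation_function :: "real measure \<Rightarrow> (real \<Rightarrow> real) \<Rightarrow> bool" where
  "truncation_function \<nu> h \<longleftrightarrow>
     h \<in> borel_measurable borel \<and> bounded (h ` {0<..}) \<and>
     ((h \<longlongrightarrow> 1) (at_right 0) \<or> (\<forall>x>0. h x = 0)) \<and>
     (\<forall>r\<ge>0. integrable \<nu> (\<lambda>x. 1 - exp (- r * x) - r * x * h x))"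

text \<open>The Levy--Khintchine form of the exponent, which has neither a Gaussian nor a further
  linear term, expresses that the process is pure jump with Levy measure \<open>\<nu>\<close>.  Integrability
  is required because \<^const>\<open>laplace_exponent\<close> would be 0 if the expectation were infinite.\<close>

definition spectrally_positive_pure_jump ::
    "'a measure \<Rightarrow> real measure \<Rightarrow> (real \<Rightarrow> real) \<Rightarrow> (real \<Rightarrow> 'a \<Rightarrow> real) \<Rightarrow> bool" where
  "spectrally_positive_pure_jump M \<nu> h S \<longleftrightarrow>
     levy_process M S \<and> positive_levy_measure \<nu> \<and> truncation_function \<nu> h \<and>
     (AE \<omega> in M. \<forall>t>0. \<forall>l. ((\<lambda>s. S s \<omega>) \<longlongrightarrow> l) (at_left t) \<longrightarrow> l \<le> S t \<omega>) \<and>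
     (\<forall>r\<ge>0. integrable M (\<lambda>\<omega>. exp (- r * S 1 \<omega>)) \<and>
        laplace_exponent M S r = (\<integral>x. 1 - exp (- r * x) - r * x * h x \<partial>\<nu>))"

definition driftless_subordinator ::
    "'a measure \<Rightarrow> real measure \<Rightarrow> (real \<Rightarrow> 'a \<Rightarrow> real) \<Rightarrow> bool" where
  "driftless_subordinator M \<nu> S \<longleftrightarrow>
     levy_process M S \<and> positive_levy_measure \<nu> \<and>
     (AE \<omega> in M. mono_on {0..} (\<lambda>t. S t \<omega>)) \<and>
     (\<integral>\<^sup>+x. ennreal (min 1 x) \<partial>\<nu>) < \<infinity> \<and>
     (\<forall>r\<ge>0. laplace_exponent M S r = (\<integral>x. 1 - exp (- r * x) \<partial>\<nu>))"

definition rational_laplace_density ::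
    "(real \<Rightarrow> real) \<Rightarrow> nat \<Rightarrow> (nat \<Rightarrow> real) \<Rightarrow> (nat \<Rightarrow> nat) \<Rightarrow> real poly \<Rightarrow> bool" where
  "rational_laplace_density f N \<alpha> n Q \<longleftrightarrow>
     f \<in> borel_measurable borel \<and> (\<forall>x. 0 \<le> f x) \<and> (\<forall>x\<le>0. f x = 0) \<and>
     (\<integral>x. f x \<partial>lborel) = 1 \<and>
     (\<forall>i\<in>{1..N}. 0 < \<alpha> i \<and> 1 \<le> n i) \<and> strict_mono_on {1..N} \<alpha> \<and>
     degree Q < (\<Sum>i=1..N. n i) \<and>
     (\<forall>r\<ge>0. (\<integral>x. exp (- r * x) * f x \<partial>lborel) = poly Q r / (\<Prod>i=1..N. (\<alpha> i + r) ^ n i))"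


section \<open>The process and the three cases\<close>

definition total_process ::
    "real \<Rightarrow> real \<Rightarrow> (real \<Rightarrow> 'a \<Rightarrow> real) \<Rightarrow> (real \<Rightarrow> 'a \<Rightarrow> real) \<Rightarrow> (real \<Rightarrow> 'a \<Rightarrow> real) \<Rightarrow>
     real \<Rightarrow> 'a \<Rightarrow> real" where
  "total_process c \<gamma> B Z S t \<omega> = c * t + \<gamma> * B t \<omega> + Z t \<omega> - S t \<omega>"

text \<open>Since \<open>Z 1\<close> is integrable, \<open>E[X 1]\<close> always exists in \<open>[-\<infinity>, \<infinity>)\<close> when \<open>c = \<gamma> = 0\<close> and \<open>S\<close>
  is a subordinator.  The value \<open>-\<infinity>\<close> is represented by a Bochner integral 0, so the
  comparisons with 0 below are the intended ones.\<close>

definition case_A ::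
    "'a measure \<Rightarrow> real measure \<Rightarrow> real \<Rightarrow> real \<Rightarrow> (real \<Rightarrow> 'a \<Rightarrow> real) \<Rightarrow> (real \<Rightarrow> 'a \<Rightarrow> real) \<Rightarrow> bool"
    where
  "case_A M \<nu> c \<gamma> S X \<longleftrightarrow> c = 0 \<and> \<gamma> = 0 \<and>
     ((driftless_subordinator M \<nu> S \<and> \<not> (\<exists>\<mu>. compound_poisson M \<mu> S)) \<or>
      ((\<exists>\<mu>. compound_poisson M \<mu> S) \<and> (\<integral>\<omega>. X 1 \<omega> \<partial>M) > 0))"

definition case_B ::
    "'a measure \<Rightarrow> real measure \<Rightarrow> real \<Rightarrow> real \<Rightarrow> (real \<Rightarrow> 'a \<Rightarrow> real) \<Rightarrow> bool" where
  "case_B M \<nu> c \<gamma> S \<longleftrightarrow> c > 0 \<and> \<gamma> = 0 \<and> driftless_subordinator M \<nu> S"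

definition case_C ::
    "'a measure \<Rightarrow> real measure \<Rightarrow> real \<Rightarrow> real \<Rightarrow> (real \<Rightarrow> 'a \<Rightarrow> real) \<Rightarrow> (real \<Rightarrow> 'a \<Rightarrow> real) \<Rightarrow> bool"
    where
  "case_C M \<nu> c \<gamma> S X \<longleftrightarrow>
     \<not> case_A M \<nu> c \<gamma> S X \<and> \<not> case_B M \<nu> c \<gamma> S \<and>
     \<not> (c = 0 \<and> \<gamma> = 0 \<and> (\<exists>\<mu>. compound_poisson M \<mu> S) \<and> (\<integral>\<omega>. X 1 \<omega> \<partial>M) \<le> 0) \<and>
     (\<integral>\<^sup>+x. ennreal (min (x\<^sup>2) x) \<partial>\<nu>) < \<infinity>"

end

theory Submission
  imports Defs
begin

text \<open>
  If \<open>S\<close> has a finite mean then its exponent is \<open>O(r)\<close> at 0, which contradicts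
  \<open>r powr - \<xi> * \<Psi>\<^sub>S r \<longlonglongrightarrow> D > 0\<close> with \<open>\<xi> < 1\<close>.  This rules out Case C and positive mean in Case A, so
  \<open>\<gamma> = 0\<close> and \<open>S\<close> is a driftless subordinator.  No Wiener--Hopf factorisation is needed then: write
  \<open>X t = Y t - S t\<close> with \<open>Y t = c * t + Z t \<ge> 0\<close>.  Since \<open>S\<close> is increasing,
  \<open>P (u < S t) \<ge> P (I t < - u) \<ge> P (a * u < S t) - P ((a - 1) * u < Y t)\<close> for every \<open>a > 1\<close>.
  The last term is \<open>O(1 / u)\<close>, because the rational transform of the jump density is differentiable
  at 0, and \<open>P (u < S t) \<sim> t * D / Gamma (1 - \<xi>) * u powr - \<xi>\<close> by Karamata's Tauberian theorem,
  as \<open>E (exp (- r * S t)) = exp (- t * \<Psi>\<^sub>S r)\<close>.  Finally \<open>u powr \<xi> * P (I t < - u) \<le> K * t\<close> for all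
  large \<open>u\<close>, so dominated convergence lets one average over the exponential time, whose mean is \<open>1 / q\<close>.
\<close>

section \<open>A Tauberian theorem for antitone functions\<close>

text \<open>The tail can be read off before the exponential averaging: the mean of
  \<open>S t\<close> is infinite for \<open>t > 0\<close>, while \<open>Y\<close> contributes only
  \<open>O(1 / u)\<close>, so at a fixed time a path falls below \<open>- u\<close> essentially only
  because \<open>S t\<close> exceeds \<open>u\<close>. The limit at time \<open>t\<close> is linear
  in \<open>t\<close>, hence only the mean of the exponential time enters the result. Two points
  need care. Limits at fixed times do not by themselves pass to a random time; the threshold in
  \<open>u\<close> for the bound \<open>K * t\<close> is common to all \<open>t\<close>, and the
  bound comes from Markov's inequality for \<open>1 - exp (- S t / u)\<close> together with
  \<open>1 - exp (- t * y) \<le> t * y\<close>. Moreover, the infimum at a random time calls for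
  measurability in time and outcome jointly, which right continuity supplies. The Tauberian theorem
  is about an antitone function instead of a measure because Fubini yields the Laplace transform of
  the tail itself; monotonicity then replaces a separate step from the integral of the tail back to
  the tail.\<close>

text \<open>Weierstrass approximation on [0,1]. Replacing \<open>g\<close> by a polynomial costs at
  most the uniform error times the total mass, and the moment of order 0 keeps the masses of
  \<open>v i\<close> bounded; the integral of a polynomial is a finite combination of
  moments.\<close>

lemma tendsto_integral_continuous_of_moments:
  fixes Y w :: "'b \<Rightarrow> real" and v :: "'i \<Rightarrow> 'b \<Rightarrow> real"
  assumes Y[measurable]: "Y \<in> borel_measurable N" and Y01: "\<And>x. Y x \<in> {0..1}"
    and v: "\<forall>\<^sub>F i in F. integrable N (v i) \<and> (\<forall>x. 0 \<le> v i x)"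
    and w: "integrable N w" "\<And>x. 0 \<le> w x"
    and moments: "\<And>k::nat. ((\<lambda>i. \<integral>x. Y x ^ k * v i x \<partial>N) \<longlongrightarrow> (\<integral>x. Y x ^ k * w x \<partial>N)) F"
    and g: "continuous_on UNIV g"
  shows "((\<lambda>i. \<integral>x. g (Y x) * v i x \<partial>N) \<longlongrightarrow> (\<integral>x. g (Y x) * w x \<partial>N)) F"
proof (rule tendstoI)
  fix e :: real assume "e > 0"
  define m where "m = (\<integral>x. w x \<partial>N)"
  have m0: "m \<ge> 0" unfolding m_def by (intro integral_nonneg_AE) (use w in auto)
  \<comment> \<open>\<open>m + 1\<close> bounds both the mass of \<open>w\<close> and, eventually,
    that of \<open>v i\<close>. Each of the two replacements of \<open>g\<close> by \<open>p\<close>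
    then costs at most \<open>e / 4\<close>, which leaves \<open>e / 2\<close> for the polynomial
    integrals.\<close>
  define d where "d = e / (4 * (m + 1))"
  have d: "d > 0" using \<open>e > 0\<close> m0 by (simp add: d_def)
  obtain p where p: "real_polynomial_function p" "\<And>x. x \<in> {0..1} \<Longrightarrow> \<bar>g x - p x\<bar> < d"
    using Stone_Weierstrass_real_polynomial_function[of "{0..1::real}" g d] d g
      continuous_on_subset by blast
  from p(1) obtain a n where pa: "p = (\<lambda>x. \<Sum>i\<le>n. a i * x ^ i)"
    using real_polynomial_function_imp_sum by blast
  have g_meas[measurable]: "g \<in> borel_measurable borel"
    using g by (rule borel_measurable_continuous_onI)
  have p_meas[measurable]: "p \<in> borel_measurable borel"
    unfolding pa by simp
  have bound_int: "integrable N (\<lambda>x. f (Y x) * u x)"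
    if f: "f \<in> borel_measurable borel" "\<And>y. y \<in> {0..1} \<Longrightarrow> \<bar>f y\<bar> \<le> K" and u: "integrable N u" for f u and K :: real
  proof (rule Bochner_Integration.integrable_bound[where f="\<lambda>x. K * u x"])
    show "integrable N (\<lambda>x. K * u x)" using u by simp
    have [measurable]: "u \<in> borel_measurable N" "f \<in> borel_measurable borel" using u f by auto
    show "(\<lambda>x. f (Y x) * u x) \<in> borel_measurable N" by simp
    have "\<bar>f (Y x)\<bar> * \<bar>u x\<bar> \<le> \<bar>K\<bar> * \<bar>u x\<bar>" for x
      by (intro mult_right_mono order_trans[OF f(2)[OF Y01[of x]]]) auto
    then show "AE x in N. norm (f (Y x) * u x) \<le> norm (K * u x)" by (simp add: abs_mult)
  qed
  have bounded_on: "\<exists>K. \<forall>y\<in>{0..1::real}. \<bar>f y\<bar> \<le> K" if "continuous_on UNIV f" for f :: "real \<Rightarrow> real"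
  proof -
    have "compact (f ` {0..1})"
      by (intro compact_continuous_image continuous_on_subset[OF that]) auto
    then have "bounded (f ` {0..1})" by (rule compact_imp_bounded)
    then show ?thesis unfolding bounded_iff by auto
  qed
  have int_g: "integrable N (\<lambda>x. g (Y x) * u x)" if "integrable N u" for u
    using bounded_on[OF g] bound_int[OF g_meas _ that] by blast
  have p_cont: "continuous_on UNIV p" unfolding pa by (intro continuous_intros)
  have int_p: "integrable N (\<lambda>x. p (Y x) * u x)" if "integrable N u" for u
    using bounded_on[OF p_cont] bound_int[OF p_meas _ that] by blast
  have int_pow: "integrable N (\<lambda>x. Y x ^ k * u x)" if "integrable N u" for u k
    by (rule bound_int[of "\<lambda>y. y ^ k" 1, OF _ _ that]) (auto simp: power_le_one)
  have p_sum: "(\<integral>x. p (Y x) * u x \<partial>N) = (\<Sum>i\<le>n. a i * (\<integral>x. Y x ^ i * u x \<partial>N))" if "integrable N u" for u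
  proof -
    have "(\<integral>x. p (Y x) * u x \<partial>N) = (\<integral>x. (\<Sum>i\<le>n. a i * (Y x ^ i * u x)) \<partial>N)"
      unfolding pa by (simp add: sum_distrib_right mult.assoc)
    also have "\<dots> = (\<Sum>i\<le>n. a i * (\<integral>x. Y x ^ i * u x \<partial>N))"
      using int_pow[OF that] by (subst Bochner_Integration.integral_sum) auto
    finally show ?thesis .
  qed
  have diff: "\<bar>(\<integral>x. g (Y x) * u x \<partial>N) - (\<integral>x. p (Y x) * u x \<partial>N)\<bar> \<le> d * (\<integral>x. u x \<partial>N)"
    if u: "integrable N u" "\<And>x. 0 \<le> u x" for u
  proof -
    have "\<bar>(\<integral>x. g (Y x) * u x \<partial>N) - (\<integral>x. p (Y x) * u x \<partial>N)\<bar> = norm (\<integral>x. (g (Y x) - p (Y x)) * u x \<partial>N)"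
      using int_g[OF u(1)] int_p[OF u(1)] by (simp add: left_diff_distrib)
    also have "\<dots> \<le> (\<integral>x. norm ((g (Y x) - p (Y x)) * u x) \<partial>N)"
      by (rule integral_norm_bound)
    also have "\<dots> \<le> (\<integral>x. d * u x \<partial>N)"
    proof (rule integral_mono)
      show "integrable N (\<lambda>x. norm ((g (Y x) - p (Y x)) * u x))"
        using int_g[OF u(1)] int_p[OF u(1)] by (intro integrable_norm) (simp add: left_diff_distrib)
      show "norm ((g (Y x) - p (Y x)) * u x) \<le> d * u x" for x
        using p(2)[OF Y01[of x]] u(2)[of x] by (auto simp: abs_mult intro!: mult_right_mono)
    qed (use u in simp)
    finally show ?thesis using u by simp
  qed
  have "((\<lambda>i. \<Sum>j\<le>n. a j * (\<integral>x. Y x ^ j * v i x \<partial>N)) \<longlongrightarrow> (\<Sum>j\<le>n. a j * (\<integral>x. Y x ^ j * w x \<partial>N))) F"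
    by (intro tendsto_intros moments)
  then have "\<forall>\<^sub>F i in F. \<bar>(\<Sum>j\<le>n. a j * (\<integral>x. Y x ^ j * v i x \<partial>N)) - (\<integral>x. p (Y x) * w x \<partial>N)\<bar> < e / 2"
    unfolding p_sum[OF w(1)] using \<open>e > 0\<close> by (auto simp: dist_real_def dest!: tendstoD[where e="e / 2"])
  moreover have "\<forall>\<^sub>F i in F. (\<integral>x. v i x \<partial>N) < m + 1"
    using order_tendstoD(2)[OF moments[of 0], of "m + 1"] by (simp add: m_def)
  ultimately show "\<forall>\<^sub>F i in F. dist (\<integral>x. g (Y x) * v i x \<partial>N) (\<integral>x. g (Y x) * w x \<partial>N) < e"
    using v
  proof eventually_elim
    case (elim i)
    have de: "d * (m + 1) = e / 4" using m0 by (simp add: d_def field_simps)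
    have "d * (\<integral>x. v i x \<partial>N) \<le> d * (m + 1)" using elim d by (intro mult_left_mono) auto
    then have 1: "\<bar>(\<integral>x. g (Y x) * v i x \<partial>N) - (\<integral>x. p (Y x) * v i x \<partial>N)\<bar> \<le> e / 4"
      using diff[of "v i"] elim de by auto
    have "d * m \<le> d * (m + 1)" using d by (intro mult_left_mono) auto
    then have 2: "\<bar>(\<integral>x. g (Y x) * w x \<partial>N) - (\<integral>x. p (Y x) * w x \<partial>N)\<bar> \<le> e / 4"
      using diff[OF w] de by (simp add: m_def)
    have "\<bar>(\<integral>x. p (Y x) * v i x \<partial>N) - (\<integral>x. p (Y x) * w x \<partial>N)\<bar> < e / 2"
      using elim p_sum[of "v i"] by simp
    with 1 2 show ?case unfolding dist_real_def by linarith
  qed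
qed

lemma has_bochner_integral_exp_powr:
  fixes a b :: real
  assumes "a > 0" "b > -1"
  shows "has_bochner_integral lborel (\<lambda>x. indicator {0..} x * (exp (- (a * x)) * x powr b))
     (Gamma (b + 1) / a powr (b + 1))"
proof -
  let ?f = "\<lambda>x::real. indicator {0..} x * (exp (- x) * x powr b)"
  have "(\<integral>\<^sup>+x. ennreal (?f x) \<partial>lborel) = ennreal (Gamma (b + 1))"
    using Gamma_conv_nn_integral_real[of "b + 1"] assms
    by (simp add: exp_minus field_simps)
  then have "has_bochner_integral lborel ?f (Gamma (b + 1))"
    using assms by (intro has_bochner_integral_nn_integral) (auto intro!: less_imp_le Gamma_real_pos)
  then have "has_bochner_integral lborel (\<lambda>x. ?f (0 + a * x)) (Gamma (b + 1) /\<^sub>R \<bar>a\<bar>)"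
    using assms by (subst lborel_has_bochner_integral_real_affine_iff[symmetric]) auto
  then have "has_bochner_integral lborel (\<lambda>x. ?f (0 + a * x) / a powr b) (Gamma (b + 1) /\<^sub>R \<bar>a\<bar> / a powr b)"
    by (rule has_bochner_integral_divide_zero)
  moreover have "?f (0 + a * x) / a powr b = indicator {0..} x * (exp (- (a * x)) * x powr b)" for x
    using assms by (auto simp: powr_mult zero_le_mult_iff split: split_indicator)
  moreover have "Gamma (b + 1) /\<^sub>R \<bar>a\<bar> / a powr b = Gamma (b + 1) / a powr (b + 1)"
    using assms by (simp add: powr_add field_simps)
  ultimately show ?thesis by simp
qed


text \<open>Karamata's method: the finite measures with densities \<open>exp (- x) * r powr - \<xi> * G (x / r)\<close>
  have convergent moments under \<open>x \<mapsto> exp (- x)\<close>, hence convergent integrals against a bump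
  function supported in \<open>[p, q]\<close>.  As \<open>G\<close> is antitone, bumps just right and just left of 1
  squeeze \<open>r powr - \<xi> * G (1 / r)\<close>.\<close>

lemma karamata_tauberian_antimono:
  fixes G :: "real \<Rightarrow> real"
  assumes xi: "\<xi> < 1" and L: "0 \<le> L"
    and G: "antimono G" "\<And>x. 0 \<le> G x" "\<And>x. G x \<le> K"
    and lim: "((\<lambda>r. r powr (1 - \<xi>) * (\<integral>u. indicator {0..} u * (exp (- (r * u)) * G u) \<partial>lborel)) \<longlongrightarrow> L) (at_right 0)"
  shows "((\<lambda>u. u powr \<xi> * G u) \<longlongrightarrow> L / Gamma (1 - \<xi>)) at_top"
proof -
  define L' where "L' = L / Gamma (1 - \<xi>)"
  have Gam: "Gamma (1 - \<xi>) > 0" using xi by (intro Gamma_real_pos) auto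
  have L': "L' \<ge> 0" unfolding L'_def using L Gam by simp
  have [measurable]: "G \<in> borel_measurable borel"
  proof -
    have "mono (\<lambda>x. - G x)" using G(1) by (auto simp: monotone_def)
    then have "(\<lambda>x. - G x) \<in> borel_measurable borel" by (rule borel_measurable_mono)
    then have "(\<lambda>x. - (- G x)) \<in> borel_measurable borel" by (rule borel_measurable_uminus)
    then show ?thesis by simp
  qed
  have exp_int: "integrable lborel (\<lambda>x. indicator {0..} x * exp (- (a * x)))" if "a > 0" for a :: real
    using has_bochner_integral_exp_powr[OF that, of 0]
    by (subst integrable_cong_AE[where g="\<lambda>x. indicator {0..} x * (exp (- (a * x)) * x powr 0)"])
       (auto simp: has_bochner_integral_iff AE_lborel_singleton split: split_indicator
         intro!: AE_I'[of "{0}"])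
  have G_int: "integrable lborel (\<lambda>u. indicator {0..} u * (exp (- (a * u)) * G (u / r)))" if "a > 0" for a r :: real
  proof (rule Bochner_Integration.integrable_bound)
    show "integrable lborel (\<lambda>x. K * (indicator {0..} x * exp (- (a * x))))" using exp_int[OF that] by simp
    show "AE x in lborel. norm (indicator {0..} x * (exp (- (a * x)) * G (x / r)))
        \<le> norm (K * (indicator {0..} x * exp (- (a * x))))"
      using G order_trans[OF G(2) G(3)] by (auto split: split_indicator simp: abs_mult)
  qed simp
  define v where "v = (\<lambda>r x. indicator {0..} x * (exp (- x) * (r powr - \<xi> * G (x / r))))"
  define w where "w = (\<lambda>x::real. L' * (indicator {0..} x * (exp (- x) * x powr - \<xi>)))"
  \<comment> \<open>The cut-off at 0 keeps \<open>Y\<close> in [0,1] on the whole line;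
    \<open>v r\<close> and \<open>w\<close> vanish on the negative half-line, so no integral feels
    it.\<close>
  define Y where "Y = (\<lambda>x::real. exp (- max 0 x))"
  have v_int: "integrable lborel (v r)" for r
    using G_int[of 1 r, THEN integrable_mult_right[of "r powr - \<xi>"]] by (simp add: v_def ac_simps)
  have w_int: "integrable lborel w"
    using has_bochner_integral_exp_powr[of 1 "- \<xi>"] xi unfolding w_def
    by (intro integrable_mult_right) (auto simp: has_bochner_integral_iff)
  have v0: "0 \<le> v r x" and w0: "0 \<le> w x" for r x
    unfolding v_def w_def using L' G(2) by auto
  \<comment> \<open>A factor \<open>Y x ^ k\<close> turns \<open>exp (- x)\<close> into
    \<open>exp (- (a * x))\<close> with \<open>a = k + 1\<close>. After the substitution
    \<open>x = r * u\<close> the moment is the expression in \<open>lim\<close> at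
    \<open>a * r\<close>, times \<open>a powr (\<xi> - 1)\<close>. The Gamma integral gives the
    moment of \<open>w\<close> the same value, which is the reason for the normalisation
    \<open>L'\<close>.\<close>
  have moments: "((\<lambda>r. \<integral>x. Y x ^ k * v r x \<partial>lborel) \<longlongrightarrow> (\<integral>x. Y x ^ k * w x \<partial>lborel)) (at_right 0)"
    for k :: nat
  proof -
    define a where "a = real (Suc k)"
    have a: "a > 0" by (simp add: a_def)
    have Ya: "Y x ^ k * exp (- x) = exp (- (a * x))" if "x \<ge> 0" for x
      using that by (simp add: Y_def a_def exp_of_nat_mult[symmetric] exp_add[symmetric] algebra_simps)
    have "(\<integral>x. Y x ^ k * v r x \<partial>lborel) =
        a powr (\<xi> - 1) * ((a * r) powr (1 - \<xi>) * (\<integral>u. indicator {0..} u * (exp (- ((a * r) * u)) * G u) \<partial>lborel))"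
      if r: "r > 0" for r
    proof -
      have "(\<integral>x. Y x ^ k * v r x \<partial>lborel)
          = (\<integral>x. r powr - \<xi> * (indicator {0..} x * (exp (- (a * x)) * G (x / r))) \<partial>lborel)"
      proof (rule Bochner_Integration.integral_cong[OF refl])
        fix x :: real
        show "Y x ^ k * v r x = r powr - \<xi> * (indicator {0..} x * (exp (- (a * x)) * G (x / r)))"
          using Ya[of x] by (auto simp: v_def split: split_indicator)
      qed
      also have "\<dots> = r powr - \<xi> * (\<integral>x. indicator {0..} x * (exp (- (a * x)) * G (x / r)) \<partial>lborel)"
        by simp
      also have "(\<integral>x. indicator {0..} x * (exp (- (a * x)) * G (x / r)) \<partial>lborel)
          = r * (\<integral>u. indicator {0..} u * (exp (- ((a * r) * u)) * G u) \<partial>lborel)"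
        using r by (subst lborel_integral_real_affine[where c=r and t=0])
          (auto simp: zero_le_mult_iff mult.assoc indicator_def intro!: Bochner_Integration.integral_cong)
      finally show ?thesis
        using r a by (simp add: powr_mult powr_minus powr_diff powr_add field_simps)
    qed
    then have "\<forall>\<^sub>F r in at_right 0. a powr (\<xi> - 1) * ((a * r) powr (1 - \<xi>) * (\<integral>u. indicator {0..} u * (exp (- ((a * r) * u)) * G u) \<partial>lborel))
        = (\<integral>x. Y x ^ k * v r x \<partial>lborel)"
      by (auto simp: eventually_at_filter)
    moreover have "filterlim (\<lambda>r. a * r) (at_right 0) (at_right 0)"
      unfolding filterlim_at
    proof
      show "\<forall>\<^sub>F r in at_right 0. a * r \<in> {0<..} \<and> a * r \<noteq> 0" using a by (auto simp: eventually_at_filter)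
      have "((\<lambda>r. a * r) \<longlongrightarrow> a * 0) (at_right 0)" by (intro tendsto_intros)
      then show "((\<lambda>r. a * r) \<longlongrightarrow> 0) (at_right 0)" by simp
    qed
    then have "((\<lambda>r. a powr (\<xi> - 1) * ((a * r) powr (1 - \<xi>) * (\<integral>u. indicator {0..} u * (exp (- ((a * r) * u)) * G u) \<partial>lborel)))
         \<longlongrightarrow> a powr (\<xi> - 1) * L) (at_right 0)"
      by (intro tendsto_mult_left filterlim_compose[OF lim])
    ultimately have "((\<lambda>r. \<integral>x. Y x ^ k * v r x \<partial>lborel) \<longlongrightarrow> a powr (\<xi> - 1) * L) (at_right 0)"
      by (rule Lim_transform_eventually[rotated])
    moreover have "(\<integral>x. Y x ^ k * w x \<partial>lborel) = a powr (\<xi> - 1) * L"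
    proof -
      have "(\<integral>x. Y x ^ k * w x \<partial>lborel) = (\<integral>x. L' * (indicator {0..} x * (exp (- (a * x)) * x powr - \<xi>)) \<partial>lborel)"
      proof (rule Bochner_Integration.integral_cong[OF refl])
        fix x :: real
        show "Y x ^ k * w x = L' * (indicator {0..} x * (exp (- (a * x)) * x powr - \<xi>))"
          using Ya[of x] by (auto simp: w_def split: split_indicator)
      qed
      also have "\<dots> = L' * (Gamma (1 - \<xi>) / a powr (1 - \<xi>))"
        using has_bochner_integral_exp_powr[of a "- \<xi>"] a xi
        by (simp add: has_bochner_integral_iff)
      also have "\<dots> = a powr (\<xi> - 1) * L"
        using Gam powr_minus[of a "1 - \<xi>"] by (simp add: L'_def field_simps)
      finally show ?thesis .
    qed
    ultimately show ?thesis by simp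
  qed
  \<comment> \<open>The bump must be a continuous function of \<open>y = exp (- x)\<close>. The
    positive part of this quadratic is nonzero exactly for \<open>exp (- q) < y < exp (- p)\<close>,
    that is, for \<open>p < x < q\<close>.\<close>
  define g where "g = (\<lambda>p q y::real. max 0 ((y - exp (- q)) * (exp (- p) - y)))"
  \<comment> \<open>The weight of the bump under \<open>exp (- x)\<close>. Comparing the factor next
    to \<open>exp (- x)\<close> with a constant \<open>b\<close> on (p, q) gives
    \<open>b * J p q\<close>; positivity of \<open>J\<close> permits cancelling it.\<close>
  define J where "J = (\<lambda>p q. \<integral>x. g p q (Y x) * (indicator {0..} x * exp (- x)) \<partial>lborel)"
  have g_cont: "continuous_on UNIV (g p q)" for p q
    unfolding g_def by (intro continuous_intros)
  have [measurable]: "g p q \<in> borel_measurable borel" for p q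
    using g_cont by (rule borel_measurable_continuous_onI)
  have [measurable]: "Y \<in> borel_measurable borel" unfolding Y_def by measurable
  have g0: "0 \<le> g p q y" for p q y by (simp add: g_def)
  have g_pos: "g p q (Y x) > 0" if "0 < p" "p < x" "x < q" for p q x
    using that by (auto simp: g_def Y_def)
  have g_eq_0: "g p q (Y x) = 0" if "0 < p" "p < q" "\<not> (p < x \<and> x < q)" for p q x
  proof (cases "x \<le> p")
    case True
    then have "exp (- p) \<le> Y x" "exp (- q) \<le> Y x" using that by (auto simp: Y_def)
    then have "(Y x - exp (- q)) * (exp (- p) - Y x) \<le> 0" by (intro mult_nonneg_nonpos) auto
    then show ?thesis by (simp add: g_def)
  next
    case False
    then have "Y x \<le> exp (- q)" "Y x \<le> exp (- p)" using that by (auto simp: Y_def)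
    then have "(Y x - exp (- q)) * (exp (- p) - Y x) \<le> 0" by (intro mult_nonpos_nonneg) auto
    then show ?thesis by (simp add: g_def)
  qed
  have g_le: "g p q (Y x) \<le> 1" if "0 < p" "p < q" for p q x
  proof (cases "p < x \<and> x < q")
    case True
    then have "(Y x - exp (- q)) * (exp (- p) - Y x) \<le> 1 * 1"
    proof (intro mult_mono)
      have "Y x \<le> 1" "0 < Y x" "exp (- p) \<le> 1" using that by (auto simp: Y_def)
      then show "Y x - exp (- q) \<le> 1" "exp (- p) - Y x \<le> 1"
        using exp_gt_zero[of "- q"] by linarith+
    qed (use True that in \<open>auto simp: Y_def\<close>)
    then show ?thesis by (simp add: g_def)
  qed (use g_eq_0[of p q] that in simp)
  have gJ_int: "integrable lborel (\<lambda>x. g p q (Y x) * (indicator {0..} x * exp (- x)))" if "0 < p" "p < q" for p q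
  proof (rule Bochner_Integration.integrable_bound[OF exp_int[of 1]])
    show "AE x in lborel. norm (g p q (Y x) * (indicator {0..} x * exp (- x))) \<le> norm (indicator {0..} x * exp (- (1 * x)))"
      using g_le[OF that] g0 by (auto split: split_indicator)
  qed auto
  have gu_int: "integrable lborel (\<lambda>x. g p q (Y x) * u x)" if "0 < p" "p < q" "integrable lborel u" for p q u
  proof (rule Bochner_Integration.integrable_bound[OF that(3)])
    have "u \<in> borel_measurable borel" using that(3) by auto
    then show "(\<lambda>x. g p q (Y x) * u x) \<in> borel_measurable lborel" by simp
    show "AE x in lborel. norm (g p q (Y x) * u x) \<le> norm (u x)"
      using g_le[OF that(1,2)] g0 by (auto simp: abs_mult mult_left_le_one_le)
  qed
  have J_pos: "J p q > 0" if "0 < p" "p < q" for p q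
  proof (rule ccontr)
    let ?f = "\<lambda>x. g p q (Y x) * (indicator {0..} x * exp (- x))"
    assume "\<not> J p q > 0"
    moreover have "J p q \<ge> 0" unfolding J_def using g0 by (intro integral_nonneg_AE) auto
    ultimately have "AE x in lborel. ?f x = 0"
      using gJ_int[OF that] g0 unfolding J_def
      by (subst integral_nonneg_eq_0_iff_AE[symmetric]) auto
    then have "AE x in lborel. x \<notin> {p<..<q}"
    proof eventually_elim
      case (elim x)
      then show ?case using g_pos[of p x q] that by (auto split: split_indicator_asm)
    qed
    then have "emeasure lborel {p<..<q} = 0"
      by (subst (asm) AE_iff_measurable[of "{p<..<q}"]) auto
    then show False using that by simp
  qed
  have conv: "((\<lambda>r. \<integral>x. g p q (Y x) * v r x \<partial>lborel) \<longlongrightarrow> (\<integral>x. g p q (Y x) * w x \<partial>lborel)) (at_right 0)" for p q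
    by (rule tendsto_integral_continuous_of_moments)
      (use v_int w_int v0 w0 moments g_cont in \<open>auto simp: Y_def\<close>)
  have le_const: "(\<integral>x. g p q (Y x) * u x \<partial>lborel) \<le> b * J p q"
    if "0 < p" "p < q" "integrable lborel u" "\<And>x. p < x \<Longrightarrow> x < q \<Longrightarrow> u x \<le> b * exp (- x)" for p q u b
  proof -
    have "(\<integral>x. g p q (Y x) * u x \<partial>lborel) \<le> (\<integral>x. b * (g p q (Y x) * (indicator {0..} x * exp (- x))) \<partial>lborel)"
    proof (rule integral_mono)
      fix x
      show "g p q (Y x) * u x \<le> b * (g p q (Y x) * (indicator {0..} x * exp (- x)))"
      proof (cases "p < x \<and> x < q")
        case True
        then show ?thesis using that(1,4) mult_left_mono[OF that(4)[of x] g0[of p q "Y x"]] by (auto simp: ac_simps)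
      qed (use g_eq_0[OF that(1,2)] in simp)
    qed (use gu_int[OF that(1-3)] gJ_int[OF that(1,2)] in auto)
    then show ?thesis by (simp add: J_def)
  qed
  have ge_const: "(\<integral>x. g p q (Y x) * u x \<partial>lborel) \<ge> b * J p q"
    if "0 < p" "p < q" "integrable lborel u" "\<And>x. p < x \<Longrightarrow> x < q \<Longrightarrow> u x \<ge> b * exp (- x)" for p q u b
    using le_const[OF that(1,2), of "\<lambda>x. - u x" "- b"] that by simp
  have "((\<lambda>r. r powr - \<xi> * G (1 / r)) \<longlongrightarrow> L') (at_right 0)"
  proof (rule order_tendstoI)
    fix a assume a: "a < L'"
    \<comment> \<open>The sign of \<open>\<xi>\<close> is not fixed here. The exponent
      \<open>- \<bar>\<xi>\<bar>\<close> gives a lower bound for \<open>x powr - \<xi>\<close> on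
      (1, q) in either case, and it still tends to 1 as \<open>q\<close> decreases to 1.\<close>
    have "((\<lambda>q::real. L' * q powr - \<bar>\<xi>\<bar>) \<longlongrightarrow> L' * 1 powr - \<bar>\<xi>\<bar>) (at_right 1)"
      by (intro tendsto_intros) auto
    then have "\<forall>\<^sub>F q in at_right 1. a < L' * q powr - \<bar>\<xi>\<bar>" using a by (auto dest: order_tendstoD(1))
    then have "\<forall>\<^sub>F q in at_right (1::real). a < L' * q powr - \<bar>\<xi>\<bar> \<and> 1 < q"
      by (intro eventually_conj) (auto simp: eventually_at_filter)
    then obtain q :: real where q: "a < L' * q powr - \<bar>\<xi>\<bar>" "1 < q"
      using eventually_happens'[OF trivial_limit_at_right_real] by blast
    have pq: "0 < (1::real)" "1 < q" using q by auto
    have "(L' * q powr - \<bar>\<xi>\<bar>) * J 1 q \<le> (\<integral>x. g 1 q (Y x) * w x \<partial>lborel)"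
    proof (rule ge_const[OF pq w_int])
      fix x assume x: "1 < x" "x < q"
      have "q powr - \<bar>\<xi>\<bar> \<le> x powr - \<bar>\<xi>\<bar>" using x by (intro powr_mono2') auto
      also have "\<dots> \<le> x powr - \<xi>" using x by (intro powr_mono) auto
      finally have "L' * q powr - \<bar>\<xi>\<bar> * exp (- x) \<le> L' * x powr - \<xi> * exp (- x)"
        using L' by (intro mult_right_mono mult_left_mono) auto
      then show "L' * q powr - \<bar>\<xi>\<bar> * exp (- x) \<le> w x" using x by (simp add: w_def ac_simps)
    qed
    then have "a * J 1 q < (\<integral>x. g 1 q (Y x) * w x \<partial>lborel)"
      using mult_strict_right_mono[OF q(1) J_pos[OF pq]] by linarith
    then have "\<forall>\<^sub>F r in at_right 0. a * J 1 q < (\<integral>x. g 1 q (Y x) * v r x \<partial>lborel)"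
      by (rule order_tendstoD(1)[OF conv])
    moreover have "\<forall>\<^sub>F r in at_right (0::real). r > 0" by (auto simp: eventually_at_filter)
    ultimately show "\<forall>\<^sub>F r in at_right 0. a < r powr - \<xi> * G (1 / r)"
    proof eventually_elim
      case (elim r)
      have "(\<integral>x. g 1 q (Y x) * v r x \<partial>lborel) \<le> r powr - \<xi> * G (1 / r) * J 1 q"
      proof (rule le_const[OF pq v_int])
        fix x assume x: "1 < x" "x < q"
        have "G (x / r) \<le> G (1 / r)" using elim x by (intro antimonoD[OF G(1)]) (auto simp: divide_right_mono)
        then have "r powr - \<xi> * G (x / r) * exp (- x) \<le> r powr - \<xi> * G (1 / r) * exp (- x)"
          by (intro mult_right_mono mult_left_mono) auto
        then show "v r x \<le> r powr - \<xi> * G (1 / r) * exp (- x)" using x by (simp add: v_def ac_simps)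
      qed
      then have "a * J 1 q < r powr - \<xi> * G (1 / r) * J 1 q" using elim by linarith
      then show ?case using J_pos[OF pq] by simp
    qed
  next
    fix a assume a: "L' < a"
    have "((\<lambda>p::real. L' * p powr - \<bar>\<xi>\<bar>) \<longlongrightarrow> L' * 1 powr - \<bar>\<xi>\<bar>) (at_left 1)"
      by (intro tendsto_intros) auto
    then have "\<forall>\<^sub>F p in at_left 1. L' * p powr - \<bar>\<xi>\<bar> < a" using a by (auto dest: order_tendstoD(2))
    moreover have "\<forall>\<^sub>F p in at_left (1::real). p > 0"
      using eventually_at_left_real[of 0 "1::real"] by (auto elim: eventually_mono)
    ultimately have "\<forall>\<^sub>F p in at_left (1::real). L' * p powr - \<bar>\<xi>\<bar> < a \<and> 0 < p \<and> p < 1"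
      by (intro eventually_conj) (auto simp: eventually_at_filter)
    then obtain p :: real where p: "L' * p powr - \<bar>\<xi>\<bar> < a" "0 < p" "p < 1"
      using eventually_happens'[OF trivial_limit_at_left_real] by blast
    have pq: "0 < p" "p < (1::real)" using p by auto
    have "(\<integral>x. g p 1 (Y x) * w x \<partial>lborel) \<le> (L' * p powr - \<bar>\<xi>\<bar>) * J p 1"
    proof (rule le_const[OF pq w_int])
      fix x assume x: "p < x" "x < 1"
      have "x powr - \<xi> \<le> x powr - \<bar>\<xi>\<bar>" using x p by (intro powr_mono') auto
      also have "\<dots> \<le> p powr - \<bar>\<xi>\<bar>" using x p by (intro powr_mono2') auto
      finally have "L' * x powr - \<xi> * exp (- x) \<le> L' * p powr - \<bar>\<xi>\<bar> * exp (- x)"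
        using L' by (intro mult_right_mono mult_left_mono) auto
      then show "w x \<le> L' * p powr - \<bar>\<xi>\<bar> * exp (- x)" using x p by (simp add: w_def ac_simps)
    qed
    then have "(\<integral>x. g p 1 (Y x) * w x \<partial>lborel) < a * J p 1"
      using mult_strict_right_mono[OF p(1) J_pos[OF pq]] by linarith
    then have "\<forall>\<^sub>F r in at_right 0. (\<integral>x. g p 1 (Y x) * v r x \<partial>lborel) < a * J p 1"
      by (rule order_tendstoD(2)[OF conv])
    moreover have "\<forall>\<^sub>F r in at_right (0::real). r > 0" by (auto simp: eventually_at_filter)
    ultimately show "\<forall>\<^sub>F r in at_right 0. r powr - \<xi> * G (1 / r) < a"
    proof eventually_elim
      case (elim r)
      have "r powr - \<xi> * G (1 / r) * J p 1 \<le> (\<integral>x. g p 1 (Y x) * v r x \<partial>lborel)"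
      proof (rule ge_const[OF pq v_int])
        fix x assume x: "p < x" "x < 1"
        have "G (1 / r) \<le> G (x / r)" using elim x by (intro antimonoD[OF G(1)]) (auto simp: divide_right_mono)
        then have "r powr - \<xi> * G (1 / r) * exp (- x) \<le> r powr - \<xi> * G (x / r) * exp (- x)"
          by (intro mult_right_mono mult_left_mono) auto
        then show "r powr - \<xi> * G (1 / r) * exp (- x) \<le> v r x" using x p by (simp add: v_def ac_simps)
      qed
      then have "r powr - \<xi> * G (1 / r) * J p 1 < a * J p 1" using elim by linarith
      then show ?case using J_pos[OF pq] by simp
    qed
  qed
  then have "((\<lambda>u. inverse u powr - \<xi> * G (1 / inverse u)) \<longlongrightarrow> L') at_top"
    unfolding filterlim_at_right_to_top .
  moreover have "\<forall>\<^sub>F u in at_top. inverse u powr - \<xi> * G (1 / inverse u) = u powr \<xi> * G u"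
    using eventually_gt_at_top[of 0]
    by eventually_elim (simp add: powr_minus inverse_powr inverse_eq_divide[symmetric])
  ultimately show ?thesis unfolding L'_def[symmetric] by (rule Lim_transform_eventually)
qed

section \<open>Running infima of cadlag processes\<close>

text \<open>Heine-Borel: right continuity bounds \<open>f\<close> below just to the right of a
  point, the left limit just to the left. This is what makes the real-valued \<open>INF\<close> in
  \<open>running_inf\<close> a genuine infimum.\<close>

lemma cadlag_bdd_below:
  assumes "cadlag f"
  shows "bdd_below (f ` {0..T})"
proof -
  have "\<exists>U b. open U \<and> x \<in> U \<and> (\<forall>y\<in>U \<inter> {0..}. b \<le> f y)" if x: "x \<in> {0..T}" for x
  proof -
    have "continuous (at_right x) f" using assms x by (simp add: cadlag_def)
    then have "(f \<longlongrightarrow> f x) (at_right x)" by (simp add: continuous_within)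
    then have "\<forall>\<^sub>F y in at_right x. f x - 1 < f y" by (rule order_tendstoD) simp
    then obtain r where r: "r > x" "\<And>y. x < y \<Longrightarrow> y < r \<Longrightarrow> f x - 1 < f y"
      unfolding eventually_at_right_field by blast
    obtain l b where l: "l < x" "\<And>y. 0 \<le> y \<Longrightarrow> l < y \<Longrightarrow> y < x \<Longrightarrow> b < f y"
    proof (cases "x > 0")
      case True
      then obtain m where "(f \<longlongrightarrow> m) (at_left x)" using assms by (auto simp: cadlag_def)
      then have "\<forall>\<^sub>F y in at_left x. m - 1 < f y" by (rule order_tendstoD) simp
      then show ?thesis using that unfolding eventually_at_left_field by blast
    \<comment> \<open>At \<open>x = 0\<close> no time in \<open>{0..}\<close> lies to the left, so
      every \<open>l < 0\<close> satisfies the condition vacuously.\<close>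
    qed (use x that[of "x - 1"] in auto)
    have "min b (f x - 1) \<le> f y" if "y \<in> {l<..<r} \<inter> {0..}" for y
      using r(2)[of y] l(2)[of y] that by (cases y x rule: linorder_cases) auto
    then show ?thesis using r(1) l(1)
      by (intro exI[of _ "{l<..<r}"] exI[of _ "min b (f x - 1)"]) auto
  qed
  then obtain U b where U: "\<And>x. x \<in> {0..T} \<Longrightarrow> open (U x) \<and> x \<in> U x \<and> (\<forall>y\<in>U x \<inter> {0..}. b x \<le> f y)"
    by metis
  obtain C where C: "C \<subseteq> {0..T}" "finite C" "{0..T} \<subseteq> (\<Union>x\<in>C. U x)"
    by (rule compactE_image[of "{0..T}" "{0..T}" U]) (use U in auto)
  have "Min (b ` C) \<le> f y" if y: "y \<in> {0..T}" for y
  proof -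
    obtain x where x: "x \<in> C" "y \<in> U x" using C(3) y by auto
    then have "Min (b ` C) \<le> b x" using C by auto
    also have "b x \<le> f y" using U[of x] C(1) x y by auto
    finally show ?thesis .
  qed
  then show ?thesis by (intro bdd_belowI2) auto
qed

lemma running_inf_less_iff:
  assumes X: "cadlag (\<lambda>t. X t \<omega>)" and t: "t \<ge> 0"
  shows "running_inf X t \<omega> < a \<longleftrightarrow> (\<exists>s\<in>{0..t}. X s \<omega> < a)"
  unfolding running_inf_def
  by (subst cINF_less_iff) (use cadlag_bdd_below[OF X] t in auto)

text \<open>Right continuity moves a time \<open>s < t\<close> with \<open>X s \<omega> < a\<close>
  to a nearby rational one. The endpoint is kept separately, since at \<open>s = t\<close> the move
  would leave the interval.\<close>

lemma running_inf_less_iff_rat: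
  assumes X: "cadlag (\<lambda>t. X t \<omega>)" and t: "t \<ge> 0"
  shows "running_inf X t \<omega> < a \<longleftrightarrow> X t \<omega> < a \<or> (\<exists>s\<in>\<rat> \<inter> {0..}. s < t \<and> X s \<omega> < a)"
  unfolding running_inf_less_iff[of X \<omega>, OF assms]
proof
  assume "\<exists>s\<in>{0..t}. X s \<omega> < a"
  then obtain s where s: "0 \<le> s" "s \<le> t" "X s \<omega> < a" by auto
  show "X t \<omega> < a \<or> (\<exists>s\<in>\<rat> \<inter> {0..}. s < t \<and> X s \<omega> < a)"
  proof (cases "s = t")
    case False
    have "((\<lambda>t. X t \<omega>) \<longlongrightarrow> X s \<omega>) (at_right s)"
      using X s(1) by (auto simp: cadlag_def continuous_within)
    then have "\<forall>\<^sub>F y in at_right s. X y \<omega> < a" using s(3) by (rule order_tendstoD)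
    then obtain r where r: "r > s" "\<And>y. s < y \<Longrightarrow> y < r \<Longrightarrow> X y \<omega> < a"
      unfolding eventually_at_right_field by blast
    have "s < min r t" using r(1) s False by auto
    then obtain y where y: "y \<in> \<rat>" "s < y" "y < min r t" using Rats_dense_in_real by blast
    then show ?thesis using r(2)[of y] s(1) by (intro disjI2 bexI[of _ y]) auto
  qed (use s in auto)
qed (use t in \<open>auto intro: less_imp_le\<close>)

section \<open>Joint measurability and evaluation at an independent random time\<close>

text \<open>Discretised times take countably many values, where measurability at fixed times
  suffices; they decrease to the true time, and right continuity passes to the limit.
  \<open>max 0\<close> makes the map total in time although \<open>X\<close> is controlled only for
  nonnegative times.\<close>

lemma cadlag_measurable_Pair:
  assumes X: "\<And>t. t \<ge> 0 \<Longrightarrow> X t \<in> borel_measurable F"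
    and paths: "\<And>\<omega>. \<omega> \<in> space F \<Longrightarrow> cadlag (\<lambda>t. X t \<omega>)"
  shows "(\<lambda>z. X (max 0 (snd z)) (fst z)) \<in> borel_measurable (F \<Otimes>\<^sub>M borel)"
proof (rule borel_measurable_LIMSEQ_real)
  let ?i = "\<lambda>k z. nat \<lfloor>real (Suc k) * max 0 (snd z)\<rfloor>"
  \<comment> \<open>The \<open>+ 1\<close> places the grid point strictly to the right of
    \<open>t\<close>, even when \<open>t\<close> itself lies on the grid.\<close>
  let ?s = "\<lambda>k (i :: nat). (real i + 1) / real (Suc k)"
  fix z :: "'a \<times> real" assume z: "z \<in> space (F \<Otimes>\<^sub>M borel)"
  define t where "t = max 0 (snd z)"
  have gt: "t < ?s k (?i k z)" and le: "?s k (?i k z) \<le> t + 1 / real (Suc k)" for k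
  proof -
    have "real (?i k z) \<le> real (Suc k) * t" "real (Suc k) * t < real (?i k z) + 1"
      by (auto simp: t_def of_nat_nat)
    moreover have "?s k (?i k z) \<le> (real (Suc k) * t + 1) / real (Suc k)"
      if "real (?i k z) \<le> real (Suc k) * t"
      using that by (intro divide_right_mono) auto
    ultimately show "?s k (?i k z) \<le> t + 1 / real (Suc k)"
      by (simp add: add_divide_distrib del: of_nat_Suc)
    show "t < ?s k (?i k z)"
      using \<open>real (Suc k) * t < real (?i k z) + 1\<close>
      by (subst pos_less_divide_eq) (simp_all add: mult.commute del: of_nat_Suc)
  qed
  have "(\<lambda>k. ?s k (?i k z)) \<longlonglongrightarrow> t"
  proof (rule tendsto_sandwich[where f="\<lambda>_. t" and h="\<lambda>k. t + 1 / real (Suc k)"])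
    show "(\<lambda>k. t + 1 / real (Suc k)) \<longlonglongrightarrow> t"
      using tendsto_add[OF tendsto_const LIMSEQ_inverse_real_of_nat, of t] by (simp add: inverse_eq_divide)
    show "\<forall>\<^sub>F k in sequentially. t \<le> ?s k (?i k z)" by (intro always_eventually allI less_imp_le gt)
    show "\<forall>\<^sub>F k in sequentially. ?s k (?i k z) \<le> t + 1 / real (Suc k)" by (intro always_eventually allI le)
  qed simp
  then have "filterlim (\<lambda>k. ?s k (?i k z)) (at_right t) sequentially"
    by (rule tendsto_imp_filterlim_at_right) (intro always_eventually allI gt)
  moreover have "((\<lambda>t. X t (fst z)) \<longlongrightarrow> X t (fst z)) (at_right t)"
    using paths[of "fst z"] z by (auto simp: cadlag_def continuous_within space_pair_measure t_def)
  ultimately show "(\<lambda>k. X (?s k (?i k z)) (fst z)) \<longlonglongrightarrow> X (max 0 (snd z)) (fst z)"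
    unfolding t_def[symmetric] by (rule filterlim_compose[rotated])
next
  fix k
  show "(\<lambda>z. X ((real (nat \<lfloor>real (Suc k) * max 0 (snd z)\<rfloor>) + 1) / real (Suc k)) (fst z)) \<in> borel_measurable (F \<Otimes>\<^sub>M borel)"
    by (rule measurable_compose_countable[where f="\<lambda>i z. X ((real i + 1) / real (Suc k)) (fst z)"])
      (auto intro!: measurable_compose[OF measurable_fst] X)
qed

text \<open>The countable union over rational times is harmless; the endpoint event, whose time
  varies with the point, is the one that calls for \<open>cadlag_measurable_Pair\<close>.
  \<open>F\<close> is arbitrary because independence will be available only for the sigma-algebra
  generated by \<open>X\<close>.\<close>

lemma running_inf_sets_Pair:
  assumes X: "\<And>t. t \<ge> 0 \<Longrightarrow> X t \<in> borel_measurable F"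
    and paths: "\<And>\<omega>. \<omega> \<in> space F \<Longrightarrow> cadlag (\<lambda>t. X t \<omega>)"
  shows "{z\<in>space (F \<Otimes>\<^sub>M borel). 0 \<le> snd z \<and> running_inf X (snd z) (fst z) < a} \<in> sets (F \<Otimes>\<^sub>M borel)"
proof -
  have [measurable]: "(\<lambda>z. X (max 0 (snd z)) (fst z)) \<in> borel_measurable (F \<Otimes>\<^sub>M borel)"
    by (rule cadlag_measurable_Pair) fact+
  have Xs[measurable]: "(\<lambda>z. X s (fst z)) \<in> borel_measurable (F \<Otimes>\<^sub>M (borel :: real measure))" if "s \<in> \<rat> \<inter> {0..}" for s
    using that by (intro measurable_compose[OF measurable_fst X]) auto
  have "countable (\<rat> \<inter> {0 :: real..})" using countable_rat by (rule countable_Int1)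
  then have *: "(\<Union>s\<in>\<rat> \<inter> {0..}. {z\<in>space (F \<Otimes>\<^sub>M borel). s < snd z \<and> X s (fst z) < a}) \<in> sets (F \<Otimes>\<^sub>M borel)"
    by (intro sets.countable_UN') (auto simp: Xs)
  have "{z\<in>space (F \<Otimes>\<^sub>M borel). 0 \<le> snd z \<and> running_inf X (snd z) (fst z) < a}
     = {z\<in>space (F \<Otimes>\<^sub>M borel). 0 \<le> snd z} \<inter> ({z\<in>space (F \<Otimes>\<^sub>M borel). X (max 0 (snd z)) (fst z) < a}
       \<union> (\<Union>s\<in>\<rat> \<inter> {0..}. {z\<in>space (F \<Otimes>\<^sub>M borel). s < snd z \<and> X s (fst z) < a}))"
    using running_inf_less_iff_rat[of X, OF paths] by (fastforce simp: space_pair_measure)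
  also have "\<dots> \<in> sets (F \<Otimes>\<^sub>M borel)"
    by (intro sets.Int sets.Un *) measurable
  finally show ?thesis .
qed

lemma running_inf_sets:
  assumes X: "\<And>t. t \<ge> 0 \<Longrightarrow> X t \<in> borel_measurable F"
    and paths: "\<And>\<omega>. \<omega> \<in> space F \<Longrightarrow> cadlag (\<lambda>t. X t \<omega>)" and t: "t \<ge> 0"
  shows "{\<omega>\<in>space F. running_inf X t \<omega> < a} \<in> sets F"
proof -
  have "(\<lambda>\<omega>. (\<omega>, t)) -` {z\<in>space (F \<Otimes>\<^sub>M borel). 0 \<le> snd z \<and> running_inf X (snd z) (fst z) < a} \<in> sets F"
    by (rule sets_Pair2[OF running_inf_sets_Pair[OF X paths]]) auto
  also have "(\<lambda>\<omega>. (\<omega>, t)) -` {z\<in>space (F \<Otimes>\<^sub>M borel). 0 \<le> snd z \<and> running_inf X (snd z) (fst z) < a}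
      = {\<omega>\<in>space F. running_inf X t \<omega> < a}"
    using t by (auto simp: space_pair_measure)
  finally show ?thesis .
qed

text \<open>Independence makes the joint law of outcome and time a product, and Tonelli's theorem
  integrates the slices at fixed times.\<close>

lemma (in prob_space) prob_running_inf_at_independent_time:
  assumes X: "\<And>t. t \<ge> 0 \<Longrightarrow> X t \<in> borel_measurable M"
    and paths: "\<And>\<omega>. \<omega> \<in> space M \<Longrightarrow> cadlag (\<lambda>t. X t \<omega>)"
    and indep: "indep_set (process_events M {0..} X) (process_events M UNIV (\<lambda>_::unit. e))"
    and e[measurable]: "e \<in> borel_measurable M" and e0: "AE \<omega> in M. 0 \<le> e \<omega>"
  shows "(\<lambda>t. indicator {0..} t * prob {\<omega>\<in>space M. running_inf X t \<omega> < a}) \<in> borel_measurable borel" (is ?meas)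
    and "prob {\<omega>\<in>space M. running_inf X (e \<omega>) \<omega> < a}
      = (\<integral>t. indicator {0..} t * prob {\<omega>\<in>space M. running_inf X t \<omega> < a} \<partial>distr M borel e)" (is ?eq)
proof -
  \<comment> \<open>The outcome space is coarsened to the events of \<open>X\<close>: the identity
    from \<open>M\<close> to \<open>F\<close> and the time \<open>e\<close> then have a product law,
    which would fail for \<open>M\<close> itself in general.\<close>
  define F where "F = sigma (space M) {X t -` A \<inter> space M | t A. t \<in> {0..} \<and> A \<in> sets borel}"
  have sets_F: "sets F = process_events M {0..} X" and space_F: "space F = space M"
    unfolding F_def process_events_def by (subst sets_measure_of space_measure_of; auto)+
  have XF: "X t \<in> borel_measurable F" if "t \<ge> 0" for t
    using that by (auto simp: measurable_def space_F sets_F process_events_def intro!: sigma_sets.Basic)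
  have id_F: "(\<lambda>\<omega>. \<omega>) \<in> measurable M F"
    using indep_setD_ev1[OF indep] by (intro measurableI) (auto simp: space_F sets_F)
  define A where "A = {z\<in>space (F \<Otimes>\<^sub>M borel). 0 \<le> snd z \<and> running_inf X (snd z) (fst z) < a}"
  have A[measurable]: "A \<in> sets (F \<Otimes>\<^sub>M borel)"
    unfolding A_def by (rule running_inf_sets_Pair) (auto simp: space_F XF paths)
  let ?D = "distr M F (\<lambda>\<omega>. \<omega>)" and ?E = "distr M borel e"
  interpret D: prob_space ?D by (rule prob_space_distr) fact
  interpret E: prob_space ?E by (rule prob_space_distr) fact
  interpret P: pair_sigma_finite ?D ?E ..
  have prod: "?D \<Otimes>\<^sub>M ?E = distr M (F \<Otimes>\<^sub>M borel) (\<lambda>\<omega>. (\<omega>, e \<omega>))"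
  proof (rule pair_measure_eqI)
    fix U V assume "U \<in> sets ?D" "V \<in> sets ?E"
    then have U: "U \<in> sets F" and V: "V \<in> sets borel" by auto
    have "e -` V \<inter> space M \<in> process_events M UNIV (\<lambda>_::unit. e)"
      using V by (auto simp: process_events_def intro!: sigma_sets.Basic)
    then have "prob (U \<inter> (e -` V \<inter> space M)) = prob U * prob (e -` V \<inter> space M)"
      using indep_setD[OF indep] U by (simp add: sets_F)
    moreover have "(\<lambda>\<omega>. (\<omega>, e \<omega>)) -` (U \<times> V) \<inter> space M = U \<inter> (e -` V \<inter> space M)"
      "(\<lambda>\<omega>. \<omega>) -` U \<inter> space M = U"
      using sets.sets_into_space[OF U] by (auto simp: space_F)
    moreover have "(\<lambda>\<omega>. (\<omega>, e \<omega>)) \<in> measurable M (F \<Otimes>\<^sub>M borel)"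
      using id_F by measurable
    ultimately show "emeasure ?D U * emeasure ?E V = emeasure (distr M (F \<Otimes>\<^sub>M borel) (\<lambda>\<omega>. (\<omega>, e \<omega>))) (U \<times> V)"
      using U V id_F by (simp add: emeasure_distr emeasure_eq_measure ennreal_mult')
  qed (auto intro: D.sigma_finite_measure_axioms E.sigma_finite_measure_axioms cong: sets_pair_measure_cong)
  have slice: "(\<lambda>\<omega>. (\<omega>, t)) -` A = (if 0 \<le> t then {\<omega>\<in>space M. running_inf X t \<omega> < a} else {})" for t
    by (auto simp: A_def space_pair_measure space_F)
  have [measurable]: "{\<omega>\<in>space M. running_inf X t \<omega> < a} \<in> sets F" if "t \<ge> 0" for t
    using running_inf_sets[of X F t a] XF paths that by (simp add: space_F)
  have meas_slice: "emeasure ?D ((\<lambda>\<omega>. (\<omega>, t)) -` A) = ennreal (indicator {0..} t * prob {\<omega>\<in>space M. running_inf X t \<omega> < a})" for t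
  proof (cases "t \<ge> 0")
    case True
    then have "emeasure ?D {\<omega>\<in>space M. running_inf X t \<omega> < a} = emeasure M {\<omega>\<in>space M. running_inf X t \<omega> < a}"
      by (subst emeasure_distr[OF id_F]) (auto intro!: arg_cong[where f="emeasure M"])
    then show ?thesis using True by (simp add: slice emeasure_eq_measure)
  qed (simp add: slice)
  have A2: "A \<in> sets (?D \<Otimes>\<^sub>M ?E)" by simp
  have "(\<lambda>t. emeasure ?D ((\<lambda>\<omega>. (\<omega>, t)) -` A)) \<in> borel_measurable ?E"
    using P.measurable_emeasure_Pair2[OF A2] .
  then have "(\<lambda>t. enn2real (ennreal (indicator {0..} t * prob {\<omega>\<in>space M. running_inf X t \<omega> < a}))) \<in> borel_measurable borel"
    unfolding meas_slice by simp
  then show meas: ?meas by (simp add: indicator_def cong: if_cong)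
  have "{\<omega>\<in>space M. 0 \<le> e \<omega> \<and> running_inf X (e \<omega>) \<omega> < a} = (\<lambda>\<omega>. (\<omega>, e \<omega>)) -` A \<inter> space M"
    by (auto simp: A_def space_pair_measure space_F)
  then have eqA: "emeasure M {\<omega>\<in>space M. 0 \<le> e \<omega> \<and> running_inf X (e \<omega>) \<omega> < a} = emeasure (distr M (F \<Otimes>\<^sub>M borel) (\<lambda>\<omega>. (\<omega>, e \<omega>))) A"
    using id_F by (subst emeasure_distr) auto
  have setsA: "{\<omega>\<in>space M. 0 \<le> e \<omega> \<and> running_inf X (e \<omega>) \<omega> < a} \<in> sets M"
    unfolding \<open>_ = (\<lambda>\<omega>. (\<omega>, e \<omega>)) -` A \<inter> space M\<close>
    by (rule measurable_sets[OF _ A]) (use id_F in measurable)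
  \<comment> \<open>At negative times the infimum is \<open>Inf {}\<close>, one fixed real for all
    outcomes. The event is therefore measurable whatever that real is, and \<open>e0\<close> makes
    it null.\<close>
  have neg: "{\<omega>\<in>space M. e \<omega> < 0 \<and> running_inf X (e \<omega>) \<omega> < a} = (if Inf {} < a then {\<omega>\<in>space M. e \<omega> < 0} else {})"
    by (auto simp: running_inf_def)
  have "{\<omega>\<in>space M. running_inf X (e \<omega>) \<omega> < a}
     = {\<omega>\<in>space M. 0 \<le> e \<omega> \<and> running_inf X (e \<omega>) \<omega> < a} \<union> {\<omega>\<in>space M. e \<omega> < 0 \<and> running_inf X (e \<omega>) \<omega> < a}"
    by auto
  also have "\<dots> \<in> sets M" using setsA unfolding neg by auto
  finally have setsB: "{\<omega>\<in>space M. running_inf X (e \<omega>) \<omega> < a} \<in> sets M" .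
  have "emeasure M {\<omega>\<in>space M. running_inf X (e \<omega>) \<omega> < a} = emeasure M {\<omega>\<in>space M. 0 \<le> e \<omega> \<and> running_inf X (e \<omega>) \<omega> < a}"
    using e0 by (intro emeasure_eq_AE setsA setsB) auto
  also have "\<dots> = emeasure (?D \<Otimes>\<^sub>M ?E) A"
    unfolding eqA prod ..
  also have "\<dots> = (\<integral>\<^sup>+t. emeasure ?D ((\<lambda>\<omega>. (\<omega>, t)) -` A) \<partial>?E)"
    by (rule P.emeasure_pair_measure_alt2[OF A2])
  also have "\<dots> = ennreal (\<integral>t. indicator {0..} t * prob {\<omega>\<in>space M. running_inf X t \<omega> < a} \<partial>?E)"
    unfolding meas_slice
    by (intro nn_integral_eq_integral E.integrable_const_bound[where B=1])
      (use meas in \<open>auto split: split_indicator\<close>)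
  finally show ?eq
    by (auto simp: emeasure_eq_measure intro!: integral_nonneg_AE split: split_indicator)
qed

lemma cadlag_total_process:
  assumes "cadlag (\<lambda>t. B t \<omega>)" "cadlag (\<lambda>t. Z t \<omega>)" "cadlag (\<lambda>t. S t \<omega>)"
  shows "cadlag (\<lambda>t. total_process c \<gamma> B Z S t \<omega>)"
  unfolding cadlag_def
proof (intro conjI allI impI)
  fix t :: real assume "t \<ge> 0"
  then show "continuous (at_right t) (\<lambda>t. total_process c \<gamma> B Z S t \<omega>)"
    using assms unfolding total_process_def cadlag_def by (intro continuous_intros) auto
next
  fix t :: real assume t: "t > 0"
  then obtain b z s where lims: "((\<lambda>t. B t \<omega>) \<longlongrightarrow> b) (at_left t)" "((\<lambda>t. Z t \<omega>) \<longlongrightarrow> z) (at_left t)"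
    "((\<lambda>t. S t \<omega>) \<longlongrightarrow> s) (at_left t)"
    using assms unfolding cadlag_def by metis
  show "\<exists>l. ((\<lambda>t. total_process c \<gamma> B Z S t \<omega>) \<longlongrightarrow> l) (at_left t)"
    unfolding total_process_def
    by (rule exI[of _ "c * t + \<gamma> * b + z - s"]) (intro tendsto_intros lims)
qed

section \<open>Laplace transforms and tails\<close>

text \<open>In Cauchy's equation nonnegativity gives monotonicity, which replaces continuity. With
  \<open>k\<close> the floor of \<open>m * t\<close>, both \<open>m * f t\<close> and
  \<open>m * t * f 1\<close> lie between \<open>k * f 1\<close> and \<open>(k + 1) * f 1\<close>, so
  \<open>m * \<bar>f t - t * f 1\<bar> \<le> f 1\<close> for every \<open>m\<close>.\<close>

lemma additive_nonneg_imp_linear: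
  fixes f :: "real \<Rightarrow> real"
  assumes add: "\<And>s t. s \<ge> 0 \<Longrightarrow> t \<ge> 0 \<Longrightarrow> f (s + t) = f s + f t"
    and nonneg: "\<And>t. t \<ge> 0 \<Longrightarrow> f t \<ge> 0" and t: "t \<ge> 0"
  shows "f t = t * f 1"
proof -
  have f0: "f 0 = 0" using add[of 0 0] by simp
  have mult: "f (real n * t) = real n * f t" if "t \<ge> 0" for n t
    by (induction n) (use that f0 in \<open>simp_all add: add algebra_simps\<close>)
  have mono: "f s \<le> f t" if "0 \<le> s" "s \<le> t" for s t
    using add[of s "t - s"] nonneg[of "t - s"] that by simp
  have "\<bar>f t - t * f 1\<bar> = 0"
  proof (rule real_archimedian_rdiv_eq_0[where c="f 1"])
    fix m :: nat
    define k where "k = nat \<lfloor>real m * t\<rfloor>"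
    have k: "real k \<le> real m * t" "real m * t \<le> real (Suc k)"
      using t by (auto simp: k_def of_nat_nat) linarith
    have "real k * f 1 \<le> real m * f t" "real m * f t \<le> real (Suc k) * f 1"
      using mono[OF _ k(1)] mono[OF _ k(2)] t mult[of 1 k] mult[of 1 "Suc k"] mult[OF t, of m] by auto
    moreover have "real k * f 1 \<le> (real m * t) * f 1" "(real m * t) * f 1 \<le> real (Suc k) * f 1"
      using k nonneg[of 1] by (intro mult_right_mono; simp)+
    ultimately have "\<bar>real m * f t - real m * t * f 1\<bar> \<le> f 1"
      by (simp add: algebra_simps abs_le_iff)
    moreover have "real m * \<bar>f t - t * f 1\<bar> = \<bar>real m * f t - real m * t * f 1\<bar>"
      by (metis abs_mult abs_of_nat mult.assoc right_diff_distrib)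
    ultimately show "real m * \<bar>f t - t * f 1\<bar> \<le> f 1" by simp
  qed simp
  then show ?thesis by simp
qed

lemma (in prob_space) integrable_exp_uminus:
  fixes Y :: "'a \<Rightarrow> real"
  assumes [measurable]: "Y \<in> borel_measurable M" and "AE \<omega> in M. 0 \<le> Y \<omega>" "0 \<le> r"
  shows "integrable M (\<lambda>\<omega>. exp (- r * Y \<omega>))"
proof (rule integrable_const_bound[where B=1])
  show "AE \<omega> in M. norm (exp (- r * Y \<omega>)) \<le> 1"
    using assms(2) by eventually_elim (use assms(3) in simp)
qed measurable

text \<open>Stationary independent increments make the transform multiplicative in time. As
  \<open>S t\<close> is nonnegative, it is at most 1, so its negative logarithm is additive and
  nonnegative, hence linear.\<close>

lemma (in prob_space) levy_laplace_transform:
  assumes S: "levy_process M S" and nonneg: "\<And>t. t \<ge> 0 \<Longrightarrow> AE \<omega> in M. 0 \<le> S t \<omega>"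
    and r: "r \<ge> 0" and t: "t \<ge> 0"
  shows "expectation (\<lambda>\<omega>. exp (- r * S t \<omega>)) = exp (- t * laplace_exponent M S r)"
proof -
  define \<phi> where "\<phi> = (\<lambda>t. expectation (\<lambda>\<omega>. exp (- r * S t \<omega>)))"
  have [measurable]: "S t \<in> borel_measurable M" if "t \<ge> 0" for t
    using S that by (simp add: levy_process_def)
  have int: "integrable M (\<lambda>\<omega>. exp (- r * S t \<omega>))" if "t \<ge> 0" for t
    using that nonneg r by (intro integrable_exp_uminus) auto
  have pos: "\<phi> t > 0" if "t \<ge> 0" for t
  proof -
    have "\<phi> t \<ge> 0" unfolding \<phi>_def by (intro integral_nonneg_AE) auto
    moreover have "\<phi> t \<noteq> 0"
      unfolding \<phi>_def using int[OF that] by (subst integral_nonneg_eq_0_iff_AE) (auto simp: AE_False)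
    ultimately show ?thesis by simp
  qed
  have le1: "\<phi> t \<le> 1" if "t \<ge> 0" for t
  proof -
    have "\<phi> t \<le> expectation (\<lambda>_. 1)"
      unfolding \<phi>_def using int[OF that] nonneg[OF that] r by (intro integral_mono_AE) auto
    then show ?thesis by (simp add: prob_space)
  qed
  have mult: "\<phi> (s + t) = \<phi> s * \<phi> t" if st: "s \<ge> 0" "t \<ge> 0" for s t
  proof -
    \<comment> \<open>The grid 0, \<open>s\<close>, \<open>s + t\<close>, constant afterwards. Its
      first increment is \<open>S s - S 0\<close>, which is identified with \<open>S s\<close>
      almost everywhere.\<close>
    define \<tau> where "\<tau> = (\<lambda>i :: nat. if i = 0 then 0 else if i = 1 then s else s + t)"
    have "indep_vars (\<lambda>_. borel) (\<lambda>i \<omega>. S (\<tau> (Suc i)) \<omega> - S (\<tau> i) \<omega>) {..<2}"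
    proof -
      have "0 \<le> \<tau> 0 \<and> (\<forall>i<2. \<tau> i \<le> \<tau> (Suc i))" using st by (auto simp: \<tau>_def)
      then show ?thesis using S unfolding levy_process_def by blast
    qed
    then have iv: "indep_vars (\<lambda>_. borel) (\<lambda>i \<omega>. exp (- r * (S (\<tau> (Suc i)) \<omega> - S (\<tau> i) \<omega>))) {..<2}"
      by (rule indep_vars_compose2) auto
    have zero: "AE \<omega> in M. S 0 \<omega> = 0" using S by (simp add: levy_process_def)
    have distr: "distr M borel (\<lambda>\<omega>. S (s + t) \<omega> - S s \<omega>) = distr M borel (S t)"
      using S st by (simp add: levy_process_def)
    have [measurable]: "(\<lambda>\<omega>. S (s + t) \<omega> - S s \<omega>) \<in> borel_measurable M" using st by simp
    have int2: "integrable M (\<lambda>\<omega>. exp (- r * (S (s + t) \<omega> - S s \<omega>)))"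
      using integrable_distr_eq[of "\<lambda>\<omega>. S (s + t) \<omega> - S s \<omega>" M borel "\<lambda>x. exp (- r * x)"]
        integrable_distr_eq[of "S t" M borel "\<lambda>x. exp (- r * x)"] int[OF st(2)] st unfolding distr by simp
    have ex2: "expectation (\<lambda>\<omega>. exp (- r * (S (s + t) \<omega> - S s \<omega>))) = \<phi> t"
      using integral_distr[of "\<lambda>\<omega>. S (s + t) \<omega> - S s \<omega>" M borel "\<lambda>x. exp (- r * x)"]
        integral_distr[of "S t" M borel "\<lambda>x. exp (- r * x)"] st unfolding distr \<phi>_def by simp
    have int1: "integrable M (\<lambda>\<omega>. exp (- r * (S s \<omega> - S 0 \<omega>)))"
      using zero st by (subst integrable_cong_AE[where g="\<lambda>\<omega>. exp (- r * S s \<omega>)"]) (use int[OF st(1)] in auto)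
    have ex1: "expectation (\<lambda>\<omega>. exp (- r * (S s \<omega> - S 0 \<omega>))) = \<phi> s"
      unfolding \<phi>_def using zero st by (intro integral_cong_AE) auto
    have "integrable M (\<lambda>\<omega>. exp (- r * (S (\<tau> (Suc i)) \<omega> - S (\<tau> i) \<omega>)))" if "i < 2" for i
      using int1 int2 that by (auto simp: \<tau>_def less_2_cases_iff)
    then have "expectation (\<lambda>\<omega>. \<Prod>i<2. exp (- r * (S (\<tau> (Suc i)) \<omega> - S (\<tau> i) \<omega>)))
        = (\<Prod>i<2. expectation (\<lambda>\<omega>. exp (- r * (S (\<tau> (Suc i)) \<omega> - S (\<tau> i) \<omega>))))"
      by (intro indep_vars_lebesgue_integral iv) auto
    also have "\<dots> = \<phi> s * \<phi> t"
      using ex1 ex2 by (simp add: \<tau>_def numeral_2_eq_2)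
    also have "expectation (\<lambda>\<omega>. \<Prod>i<2. exp (- r * (S (\<tau> (Suc i)) \<omega> - S (\<tau> i) \<omega>))) = \<phi> (s + t)"
      unfolding \<phi>_def using zero st
      by (intro integral_cong_AE) (auto simp: \<tau>_def numeral_2_eq_2 exp_add[symmetric] algebra_simps)
    finally show ?thesis .
  qed
  have "- ln (\<phi> t) = t * - ln (\<phi> 1)"
  proof (rule additive_nonneg_imp_linear[where f="\<lambda>t. - ln (\<phi> t)"])
    show "- ln (\<phi> (s + t)) = - ln (\<phi> s) + - ln (\<phi> t)" if "s \<ge> 0" "t \<ge> 0" for s t
      using pos[OF that(1)] pos[OF that(2)] by (simp add: mult[OF that] ln_mult)
    show "- ln (\<phi> t) \<ge> 0" if "t \<ge> 0" for t
      using pos[OF that] le1[OF that] by simp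
  qed (rule t)
  then have "ln (\<phi> t) = - t * laplace_exponent M S r" by (simp add: \<phi>_def laplace_exponent_def)
  moreover have "exp (ln (\<phi> t)) = \<phi> t" using pos[OF t] by simp
  ultimately show ?thesis by (simp add: \<phi>_def)
qed

text \<open>\<open>1 - exp (- r * y)\<close> is the integral of \<open>r * exp (- (r * u))\<close>
  over \<open>u\<close> in [0, y]; Tonelli exchanges this integral with the expectation.\<close>

lemma (in prob_space) laplace_transform_eq_integral_tail:
  fixes Y :: "'a \<Rightarrow> real"
  assumes [measurable]: "Y \<in> borel_measurable M" and nonneg: "AE \<omega> in M. 0 \<le> Y \<omega>" and r: "r > 0"
  shows "1 - expectation (\<lambda>\<omega>. exp (- r * Y \<omega>))
    = r * (\<integral>u. indicator {0..} u * (exp (- (r * u)) * prob {\<omega>\<in>space M. u < Y \<omega>}) \<partial>lborel)"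
proof -
  interpret P: pair_sigma_finite lborel M ..
  have [measurable]: "(\<lambda>u. prob {\<omega>\<in>space M. u < Y \<omega>}) \<in> borel_measurable borel"
    by measurable
  have FTC: "(\<integral>\<^sup>+u. ennreal (r * exp (- (r * u))) * indicator {0..y} u \<partial>lborel) = ennreal (1 - exp (- r * y))"
    if "y \<ge> 0" for y
    by (subst nn_integral_FTC_Icc[where F="\<lambda>u. - exp (- (r * u))"])
      (use that r in \<open>auto intro!: derivative_eq_intros\<close>)
  have "(\<integral>\<^sup>+\<omega>. ennreal (1 - exp (- r * Y \<omega>)) \<partial>M)
      = (\<integral>\<^sup>+\<omega>. (\<integral>\<^sup>+u. ennreal (indicator {0..} u * (r * exp (- (r * u)))) * indicator {\<omega>\<in>space M. u < Y \<omega>} \<omega> \<partial>lborel) \<partial>M)"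
  proof (rule nn_integral_cong_AE)
    show "AE \<omega> in M. ennreal (1 - exp (- r * Y \<omega>)) =
       (\<integral>\<^sup>+u. ennreal (indicator {0..} u * (r * exp (- (r * u)))) * indicator {\<omega>\<in>space M. u < Y \<omega>} \<omega> \<partial>lborel)"
      using nonneg AE_space
    proof eventually_elim
      case (elim \<omega>)
      have "(\<integral>\<^sup>+u. ennreal (indicator {0..} u * (r * exp (- (r * u)))) * indicator {\<omega>\<in>space M. u < Y \<omega>} \<omega> \<partial>lborel)
         = (\<integral>\<^sup>+u. ennreal (r * exp (- (r * u))) * indicator {0..Y \<omega>} u \<partial>lborel)"
        \<comment> \<open>The condition \<open>u < Y \<omega>\<close> and the closed interval differ
          in the single point \<open>u = Y \<omega>\<close>.\<close>
        using AE_lborel_singleton[of "Y \<omega>"] elim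
        by (intro nn_integral_cong_AE) (auto split: split_indicator elim!: eventually_mono)
      then show ?case using FTC elim by simp
    qed
  qed
  also have "\<dots> = (\<integral>\<^sup>+u. (\<integral>\<^sup>+\<omega>. ennreal (indicator {0..} u * (r * exp (- (r * u)))) * indicator {\<omega>\<in>space M. u < Y \<omega>} \<omega> \<partial>M) \<partial>lborel)"
  proof -
    have "(\<lambda>(u, \<omega>). ennreal (indicator {0..} u * (r * exp (- (r * u)))) * indicator {\<omega>\<in>space M. u < Y \<omega>} \<omega>)
      \<in> borel_measurable (lborel \<Otimes>\<^sub>M M)"
      unfolding indicator_def[of "{\<omega>\<in>space M. _ < Y \<omega>}"] by measurable
    then show ?thesis by (rule P.Fubini')
  qed
  also have "\<dots> = (\<integral>\<^sup>+u. ennreal (r * (indicator {0..} u * (exp (- (r * u)) * prob {\<omega>\<in>space M. u < Y \<omega>}))) \<partial>lborel)"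
  proof (intro nn_integral_cong)
    fix u :: real
    let ?A = "{\<omega>\<in>space M. u < Y \<omega>}"
    have "(\<integral>\<^sup>+\<omega>. ennreal (indicator {0..} u * (r * exp (- (r * u)))) * indicator ?A \<omega> \<partial>M)
        = ennreal (indicator {0..} u * (r * exp (- (r * u)))) * ennreal (prob ?A)"
      by (subst nn_integral_cmult_indicator) (simp_all add: emeasure_eq_measure)
    also have "\<dots> = ennreal (indicator {0..} u * (r * exp (- (r * u))) * prob ?A)"
      using r by (intro ennreal_mult'[symmetric]) simp
    also have "indicator {0..} u * (r * exp (- (r * u))) * prob ?A = r * (indicator {0..} u * (exp (- (r * u)) * prob ?A))"
      by simp
    finally show "(\<integral>\<^sup>+\<omega>. ennreal (indicator {0..} u * (r * exp (- (r * u)))) * indicator ?A \<omega> \<partial>M)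
        = ennreal (r * (indicator {0..} u * (exp (- (r * u)) * prob ?A)))" .
  qed
  finally have eq: "(\<integral>\<^sup>+\<omega>. ennreal (1 - exp (- r * Y \<omega>)) \<partial>M) = \<dots>" .
  have int: "integrable M (\<lambda>\<omega>. exp (- r * Y \<omega>))" using nonneg r by (intro integrable_exp_uminus) auto
  have "1 - expectation (\<lambda>\<omega>. exp (- r * Y \<omega>)) = expectation (\<lambda>\<omega>. 1 - exp (- r * Y \<omega>))"
    using int by (simp add: prob_space)
  also have "\<dots> = enn2real (\<integral>\<^sup>+\<omega>. ennreal (1 - exp (- r * Y \<omega>)) \<partial>M)"
    using nonneg r by (intro integral_eq_nn_integral) auto
  also have "\<dots> = (\<integral>u. r * (indicator {0..} u * (exp (- (r * u)) * prob {\<omega>\<in>space M. u < Y \<omega>})) \<partial>lborel)"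
    unfolding eq using r by (intro integral_eq_nn_integral[symmetric]) auto
  finally show ?thesis by simp
qed

lemma (in prob_space) tail_tendsto_of_laplace_transform:
  fixes Y :: "'a \<Rightarrow> real"
  assumes Y[measurable]: "Y \<in> borel_measurable M" and nonneg: "AE \<omega> in M. 0 \<le> Y \<omega>"
    and xi: "\<xi> < 1" and L: "0 \<le> L"
    and lim: "((\<lambda>r. r powr (- \<xi>) * (1 - expectation (\<lambda>\<omega>. exp (- r * Y \<omega>)))) \<longlongrightarrow> L) (at_right 0)"
  shows "((\<lambda>u. u powr \<xi> * prob {\<omega>\<in>space M. u < Y \<omega>}) \<longlongrightarrow> L / Gamma (1 - \<xi>)) at_top"
proof (rule karamata_tauberian_antimono[OF xi L, where K=1])
  show "antimono (\<lambda>u. prob {\<omega>\<in>space M. u < Y \<omega>})"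
    by (intro antimonoI finite_measure_mono) auto
  have "\<forall>\<^sub>F r in at_right 0. r powr (- \<xi>) * (1 - expectation (\<lambda>\<omega>. exp (- r * Y \<omega>)))
     = r powr (1 - \<xi>) * (\<integral>u. indicator {0..} u * (exp (- (r * u)) * prob {\<omega>\<in>space M. u < Y \<omega>}) \<partial>lborel)"
    unfolding eventually_at_filter
  proof (intro always_eventually allI impI)
    fix r :: real assume "r \<in> {0<..}"
    then have "r > 0" by simp
    show "r powr (- \<xi>) * (1 - expectation (\<lambda>\<omega>. exp (- r * Y \<omega>)))
      = r powr (1 - \<xi>) * (\<integral>u. indicator {0..} u * (exp (- (r * u)) * prob {\<omega>\<in>space M. u < Y \<omega>}) \<partial>lborel)"
      unfolding laplace_transform_eq_integral_tail[OF Y nonneg \<open>r > 0\<close>]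
      using \<open>r > 0\<close> by (simp add: powr_diff powr_minus field_simps)
  qed
  then show "((\<lambda>r. r powr (1 - \<xi>) * (\<integral>u. indicator {0..} u * (exp (- (r * u)) * prob {\<omega>\<in>space M. u < Y \<omega>}) \<partial>lborel)) \<longlongrightarrow> L) (at_right 0)"
    by (rule Lim_transform_eventually[OF lim])
qed auto

text \<open>Markov's inequality for the increasing function \<open>1 - exp (- y / u)\<close>, which
  exceeds \<open>1 - exp (- 1)\<close> beyond \<open>u\<close>. It also works for infinite means,
  and gives both the decay \<open>O(1 / u)\<close> of \<open>Y\<close> and the dominating bound for
  \<open>S\<close>.\<close>

lemma (in prob_space) tail_le_laplace_transform:
  fixes Y :: "'a \<Rightarrow> real"
  assumes [measurable]: "Y \<in> borel_measurable M" and nonneg: "AE \<omega> in M. 0 \<le> Y \<omega>" and u: "u > 0"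
  shows "prob {\<omega>\<in>space M. u < Y \<omega>} \<le> (1 - expectation (\<lambda>\<omega>. exp (- (1 / u) * Y \<omega>))) / (1 - exp (- 1))"
proof -
  have int: "integrable M (\<lambda>\<omega>. exp (- (1 / u) * Y \<omega>))" using nonneg u by (intro integrable_exp_uminus) auto
  have "(1 - exp (- 1)) * prob {\<omega>\<in>space M. u < Y \<omega>} = expectation (\<lambda>\<omega>. (1 - exp (- 1)) * indicator {\<omega>\<in>space M. u < Y \<omega>} \<omega>)"
    by simp
  also have "\<dots> \<le> expectation (\<lambda>\<omega>. 1 - exp (- (1 / u) * Y \<omega>))"
  proof (rule integral_mono_AE)
    show "AE \<omega> in M. (1 - exp (- 1)) * indicator {\<omega>\<in>space M. u < Y \<omega>} \<omega> \<le> 1 - exp (- (1 / u) * Y \<omega>)"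
      using nonneg u by (auto split: split_indicator simp: field_simps elim!: eventually_mono)
  qed (use int in \<open>auto intro!: integrable_real_indicator simp: emeasure_eq_measure\<close>)
  also have "\<dots> = 1 - expectation (\<lambda>\<omega>. exp (- (1 / u) * Y \<omega>))"
    using int by (simp add: prob_space)
  finally show ?thesis by (simp add: field_simps)
qed

section \<open>Compound Poisson processes\<close>

text \<open>Iterates \<open>1 - a * b \<le> (1 - a) + (1 - b)\<close>, which is
  \<open>(1 - a) * (1 - b) \<ge> 0\<close>.\<close>

lemma one_minus_exp_sum_le:
  fixes x :: "nat \<Rightarrow> real"
  assumes "r \<ge> 0" "\<And>i. x i \<ge> 0"
  shows "1 - exp (- r * (\<Sum>i<k. x i)) \<le> (\<Sum>i<k. 1 - exp (- r * x i))"
proof (induction k)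
  case (Suc k)
  define a b where "a = exp (- r * (\<Sum>i<k. x i))" and "b = exp (- r * x k)"
  have "a \<le> 1" "b \<le> 1" using assms by (auto simp: a_def b_def sum_nonneg)
  then have "0 \<le> (1 - a) * (1 - b)" by (intro mult_nonneg_nonneg) auto
  then have "1 - a * b \<le> (1 - a) + (1 - b)" by (simp add: algebra_simps)
  moreover have "exp (- r * (\<Sum>i<Suc k. x i)) = a * b"
    by (simp add: a_def b_def exp_add[symmetric] algebra_simps)
  ultimately show ?case using Suc.IH by (simp add: a_def b_def)
qed simp

lemma summable_real_mult_poisson: "summable (\<lambda>k. real k * (exp (- x) * x ^ k / fact k))"
proof -
  have "summable (\<lambda>k. exp (- x) * x * (inverse (fact k) * x ^ k))"
    by (intro summable_mult summable_exp)
  moreover have "exp (- x) * x * (inverse (fact k) * x ^ k) = real (Suc k) * (exp (- x) * x ^ Suc k / fact (Suc k))" for k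
    unfolding fact_Suc of_nat_mult by (simp add: divide_simps del: of_nat_Suc)
  ultimately show ?thesis by (subst summable_Suc_iff[symmetric]) simp
qed

lemma (in prob_space) indep_process_events_imp_indep_var:
  assumes indep: "indep_set (process_events M S X) (process_events M T Y)"
    and "s \<in> S" "t \<in> T" and [measurable]: "X s \<in> borel_measurable M" "Y t \<in> borel_measurable M"
  shows "indep_var borel (X s) borel (Y t)"
proof -
  have sub: "sigma_sets (space M) {X s -` A \<inter> space M |A. A \<in> sets borel} \<subseteq> process_events M S X"
    if "s \<in> S" for s S and X :: "'z \<Rightarrow> 'a \<Rightarrow> real"
    unfolding process_events_def using that by (intro sigma_sets_subseteq) auto
  show ?thesis unfolding indep_var_eq
  proof (intro conjI)
    show "indep_set (sigma_sets (space M) {X s -` A \<inter> space M |A. A \<in> sets borel})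
        (sigma_sets (space M) {Y t -` A \<inter> space M |A. A \<in> sets borel})"
      using indep sub[OF assms(2), of X] sub[OF assms(3), of Y] unfolding indep_sets2_eq
      by (meson subset_iff)
  qed fact+
qed

lemma (in prob_space) AE_jumps_pos:
  fixes J :: "nat \<Rightarrow> 'a \<Rightarrow> real"
  assumes [measurable]: "\<And>k. J k \<in> borel_measurable M"
    and law: "\<And>k A. A \<in> sets borel \<Longrightarrow> emeasure \<nu> A = ennreal l * emeasure M {\<omega>\<in>space M. J k \<omega> \<in> A}"
    and pos: "emeasure \<nu> {..0} = 0" and l: "l > 0"
  shows "AE \<omega> in M. \<forall>k. 0 < J k \<omega>"
proof -
  have "AE \<omega> in M. 0 < J k \<omega>" for k
  proof (rule AE_I')
    show "{\<omega>\<in>space M. J k \<omega> \<in> {..0}} \<in> null_sets M"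
      using law[of "{..0}" k] pos l by (intro null_setsI) auto
  qed auto
  then show ?thesis by (simp add: AE_all_countable)
qed

lemma (in prob_space) compound_poisson_nonneg:
  assumes cp: "compound_poisson M \<nu> Z" and pos: "emeasure \<nu> {..0} = 0"
  shows "AE \<omega> in M. \<forall>t\<ge>0. 0 \<le> Z t \<omega>"
proof -
  obtain l N J where l: "l > (0::real)"
    and J: "indep_vars (\<lambda>_. borel) J UNIV"
    and law: "\<And>k A. A \<in> sets borel \<Longrightarrow> emeasure \<nu> A = ennreal l * emeasure M {\<omega>\<in>space M. J k \<omega> \<in> A}"
    and Z: "AE \<omega> in M. \<forall>t\<ge>0. Z t \<omega> = (\<Sum>i<N t \<omega>. J (i :: nat) \<omega>)"
    using cp unfolding compound_poisson_def by (elim conjE exE) (erule that, (assumption | blast)+)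
  have J_meas[measurable]: "J k \<in> borel_measurable M" for k using J by (simp add: indep_vars_def)
  have "AE \<omega> in M. \<forall>k. 0 < J k \<omega>" by (rule AE_jumps_pos[OF J_meas law pos l])
  with Z show ?thesis by eventually_elim (simp add: sum_nonneg less_imp_le)
qed

text \<open>An upper bound is enough, so subadditivity over the jumps stands in for the exact
  exponential formula: the left side is at most the mean number of jumps times the contribution of
  one jump. The jump law is \<open>\<nu> / l\<close>, so \<open>m\<close> is the mean of
  \<open>N t\<close> divided by \<open>l\<close>, kept as a series.\<close>

lemma (in prob_space) compound_poisson_laplace_bound:
  assumes cp: "compound_poisson M \<nu> Z" and pos: "emeasure \<nu> {..0} = 0" and t: "t \<ge> 0"
  shows "\<exists>m\<ge>0. \<forall>r\<ge>0. (\<integral>\<^sup>+\<omega>. ennreal (1 - exp (- r * Z t \<omega>)) \<partial>M)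
     \<le> ennreal m * (\<integral>\<^sup>+x. ennreal (1 - exp (- r * x)) \<partial>\<nu>)"
proof -
  obtain l N J where l: "l > (0::real)" and N: "poisson_process M l N"
    and J: "indep_vars (\<lambda>_. borel) J UNIV"
    and law: "\<And>k A. A \<in> sets borel \<Longrightarrow> emeasure \<nu> A = ennreal l * emeasure M {\<omega>\<in>space M. J k \<omega> \<in> A}"
    and indep: "indep_set (process_events M {0..} (\<lambda>t \<omega>. real (N t \<omega>))) (process_events M UNIV J)"
    and Z: "AE \<omega> in M. \<forall>t\<ge>0. Z t \<omega> = (\<Sum>i<N t \<omega>. J (i :: nat) \<omega>)"
    using cp unfolding compound_poisson_def by (elim conjE exE) (erule that, (assumption | blast)+)
  have sets_\<nu>: "sets \<nu> = sets borel" using cp by (simp add: compound_poisson_def)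
  have J_meas[measurable]: "J k \<in> borel_measurable M" for k using J by (simp add: indep_vars_def)
  have N_meas[measurable]: "(\<lambda>\<omega>. real (N t \<omega>)) \<in> borel_measurable M"
    using N t by (simp add: poisson_process_def levy_process_def)
  have J_pos: "AE \<omega> in M. \<forall>k. 0 < J k \<omega>" by (rule AE_jumps_pos[OF J_meas law pos l])
  define p where "p = (\<lambda>k. exp (- (l * t)) * (l * t) ^ k / fact k)"
  have p_eq: "prob {\<omega>\<in>space M. N t \<omega> = k} = p k" for k
    using N t by (simp add: poisson_process_def p_def)
  have p0: "p k \<ge> 0" for k unfolding p_eq[symmetric] by simp
  have p_sum: "summable (\<lambda>k. real k * p k / l)"
    unfolding p_def by (intro summable_divide summable_real_mult_poisson)
  have \<nu>_eq: "\<nu> = scale_measure (ennreal l) (distr M borel (J i))" for i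
  proof (rule measure_eqI)
    fix A assume "A \<in> sets \<nu>"
    then have A: "A \<in> sets borel" by (simp add: sets_\<nu>)
    have "J i -` A \<inter> space M = {\<omega>\<in>space M. J i \<omega> \<in> A}" by auto
    then show "emeasure \<nu> A = emeasure (scale_measure (ennreal l) (distr M borel (J i))) A"
      using law[OF A, of i] A by (simp add: emeasure_distr)
  qed (simp add: sets_\<nu>)
  have bound: "(\<integral>\<^sup>+\<omega>. ennreal (1 - exp (- r * Z t \<omega>)) \<partial>M)
     \<le> ennreal (\<Sum>k. real k * p k / l) * (\<integral>\<^sup>+x. ennreal (1 - exp (- r * x)) \<partial>\<nu>)" if r: "r \<ge> 0" for r
  proof -
    \<comment> \<open>\<open>max 0\<close> confines \<open>g\<close> to [0,1] everywhere, while
      jumps are positive only almost everywhere.\<close>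
    define g where "g = (\<lambda>x. 1 - exp (- r * max 0 x))"
    define I where "I = (\<integral>\<^sup>+x. ennreal (1 - exp (- r * x)) \<partial>\<nu>)"
    have g_meas[measurable]: "g \<in> borel_measurable borel" unfolding g_def by measurable
    have g01: "0 \<le> g x" "g x \<le> 1" for x using r by (auto simp: g_def)
    have AE_g: "AE \<omega> in M. g (J i \<omega>) = 1 - exp (- r * J i \<omega>)" for i
      using J_pos by eventually_elim (auto simp: g_def max_def dest: spec[of _ i])
    have Eg: "(\<integral>\<^sup>+\<omega>. ennreal (g (J i \<omega>)) \<partial>M) = ennreal (1 / l) * I" for i
    proof -
      have "(\<integral>\<^sup>+\<omega>. ennreal (g (J i \<omega>)) \<partial>M) = (\<integral>\<^sup>+\<omega>. ennreal (1 - exp (- r * J i \<omega>)) \<partial>M)"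
        using AE_g[of i] by (intro nn_integral_cong_AE) auto
      moreover have "I = ennreal l * (\<integral>\<^sup>+\<omega>. ennreal (1 - exp (- r * J i \<omega>)) \<partial>M)"
        unfolding I_def \<nu>_eq[of i] by (subst nn_integral_scale_measure) (simp_all add: nn_integral_distr)
      moreover have "ennreal (1 / l) * ennreal l = 1"
        using l by (subst ennreal_mult'[symmetric]) auto
      ultimately show ?thesis by (simp add: mult.assoc[symmetric])
    qed
    have term_eq: "(\<integral>\<^sup>+\<omega>. indicator {\<omega>\<in>space M. N t \<omega> = k} \<omega> * ennreal (g (J i \<omega>)) \<partial>M) = ennreal (p k / l) * I" for k i
    proof -
      have "indep_var borel (\<lambda>\<omega>. real (N t \<omega>)) borel (J i)"
        using indep_process_events_imp_indep_var[OF indep, of t i] t by auto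
      then have "indep_var borel ((indicator {real k} :: real \<Rightarrow> real) \<circ> (\<lambda>\<omega>. real (N t \<omega>))) borel (g \<circ> J i)"
        by (rule indep_var_compose) auto
      moreover have "integrable M ((indicator {real k} :: real \<Rightarrow> real) \<circ> (\<lambda>\<omega>. real (N t \<omega>)))" "integrable M (g \<circ> J i)"
        using g01 by (intro integrable_const_bound[where B=1]; auto simp: o_def split: split_indicator)+
      ultimately have fac: "expectation (\<lambda>\<omega>. indicator {real k} (real (N t \<omega>)) * g (J i \<omega>))
          = expectation (\<lambda>\<omega>. indicator {real k} (real (N t \<omega>))) * expectation (\<lambda>\<omega>. g (J i \<omega>))"
        using indep_var_lebesgue_integral[of "(indicator {real k} :: real \<Rightarrow> real) \<circ> (\<lambda>\<omega>. real (N t \<omega>))" "g \<circ> J i"]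
        by (simp add: o_def)
      have "{\<omega>\<in>space M. real (N t \<omega>) = real k} \<in> sets M" by measurable
      then have [measurable]: "{\<omega>\<in>space M. N t \<omega> = k} \<in> sets M" by simp
      have "expectation (\<lambda>\<omega>. indicator {real k} (real (N t \<omega>)) :: real) = expectation (\<lambda>\<omega>. indicator {\<omega>\<in>space M. N t \<omega> = k} \<omega>)"
        by (intro Bochner_Integration.integral_cong) (auto split: split_indicator)
      then have pk: "expectation (\<lambda>\<omega>. indicator {real k} (real (N t \<omega>))) = p k"
        by (simp add: p_eq)
      have "(\<integral>\<^sup>+\<omega>. indicator {\<omega>\<in>space M. N t \<omega> = k} \<omega> * ennreal (g (J i \<omega>)) \<partial>M)
          = (\<integral>\<^sup>+\<omega>. ennreal (indicator {real k} (real (N t \<omega>)) * g (J i \<omega>)) \<partial>M)"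
        by (intro nn_integral_cong) (auto split: split_indicator)
      also have "\<dots> = ennreal (expectation (\<lambda>\<omega>. indicator {real k} (real (N t \<omega>)) * g (J i \<omega>)))"
        using g01 by (intro nn_integral_eq_integral integrable_const_bound[where B=1]) (auto split: split_indicator)
      also have "\<dots> = ennreal (p k) * ennreal (expectation (\<lambda>\<omega>. g (J i \<omega>)))"
        unfolding fac pk using p0 by (rule ennreal_mult')
      also have "ennreal (expectation (\<lambda>\<omega>. g (J i \<omega>))) = (\<integral>\<^sup>+\<omega>. ennreal (g (J i \<omega>)) \<partial>M)"
        using g01 by (intro nn_integral_eq_integral[symmetric] integrable_const_bound[where B=1]) auto
      also have "ennreal (p k) * \<dots> = ennreal (p k / l) * I"
        unfolding Eg using l p0[of k] by (simp add: mult.assoc[symmetric] ennreal_mult'[symmetric])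
      finally show ?thesis .
    qed
    have [measurable]: "{\<omega>\<in>space M. N t \<omega> = k} \<in> sets M" for k
    proof -
      have "{\<omega>\<in>space M. real (N t \<omega>) = real k} \<in> sets M" by measurable
      then show ?thesis by simp
    qed
    \<comment> \<open>For a given outcome only the term \<open>k = N t \<omega>\<close> of the
      series is nonzero. Writing the random sum in this way lets each summand factor by
      \<open>term_eq\<close>.\<close>
    have "AE \<omega> in M. ennreal (1 - exp (- r * Z t \<omega>))
       \<le> (\<Sum>k. \<Sum>i<k. indicator {\<omega>\<in>space M. N t \<omega> = k} \<omega> * ennreal (g (J i \<omega>)))"
      using Z J_pos AE_space
    proof eventually_elim
      case (elim \<omega>)
      define k where "k = N t \<omega>"
      have "1 - exp (- r * Z t \<omega>) \<le> (\<Sum>i<k. 1 - exp (- r * J i \<omega>))"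
        using elim t r one_minus_exp_sum_le[of r "\<lambda>i. J i \<omega>" k] by (simp add: k_def less_imp_le)
      also have "\<dots> = (\<Sum>i<k. g (J i \<omega>))"
        using elim by (intro sum.cong) (simp_all add: g_def max_def less_imp_le)
      finally have "ennreal (1 - exp (- r * Z t \<omega>)) \<le> ennreal (\<Sum>i<k. g (J i \<omega>))" by (rule ennreal_leI)
      also have "\<dots> = (\<Sum>i<k. indicator {\<omega>\<in>space M. N t \<omega> = k} \<omega> * ennreal (g (J i \<omega>)))"
        using g01 elim by (simp add: sum_ennreal k_def)
      also have "\<dots> \<le> (\<Sum>k. \<Sum>i<k. indicator {\<omega>\<in>space M. N t \<omega> = k} \<omega> * ennreal (g (J i \<omega>)))"
        using sum_le_suminf[of "\<lambda>k. \<Sum>i<k. indicator {\<omega>\<in>space M. N t \<omega> = k} \<omega> * ennreal (g (J i \<omega>))" "{k}"]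
        by simp
      finally show ?case .
    qed
    then have "(\<integral>\<^sup>+\<omega>. ennreal (1 - exp (- r * Z t \<omega>)) \<partial>M)
        \<le> (\<integral>\<^sup>+\<omega>. (\<Sum>k. \<Sum>i<k. indicator {\<omega>\<in>space M. N t \<omega> = k} \<omega> * ennreal (g (J i \<omega>))) \<partial>M)"
      by (rule nn_integral_mono_AE)
    also have "\<dots> = (\<Sum>k. (\<integral>\<^sup>+\<omega>. (\<Sum>i<k. indicator {\<omega>\<in>space M. N t \<omega> = k} \<omega> * ennreal (g (J i \<omega>))) \<partial>M))"
      by (intro nn_integral_suminf) measurable
    also have "\<dots> = (\<Sum>k. \<Sum>i<k. (\<integral>\<^sup>+\<omega>. indicator {\<omega>\<in>space M. N t \<omega> = k} \<omega> * ennreal (g (J i \<omega>)) \<partial>M))"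
      by (intro suminf_cong nn_integral_sum) measurable
    also have "\<dots> = (\<Sum>k. ennreal (real k * p k / l) * I)"
      unfolding term_eq using p0 l
      by (simp add: mult.assoc[symmetric] ennreal_of_nat_eq_real_of_nat ennreal_mult'[symmetric])
    also have "\<dots> = (\<Sum>k. ennreal (real k * p k / l)) * I" by simp
    also have "(\<Sum>k. ennreal (real k * p k / l)) = ennreal (\<Sum>k. real k * p k / l)"
      using p0 l p_sum by (intro suminf_ennreal2) auto
    finally show ?thesis unfolding I_def .
  qed
  have "(\<Sum>k. real k * p k / l) \<ge> 0"
    using p0 l p_sum by (intro suminf_nonneg) auto
  with bound show ?thesis by blast
qed

text \<open>The denominator at 0 is a product of powers of the positive \<open>\<alpha> i\<close>,
  so the transform agrees for \<open>r \<ge> 0\<close> with a function differentiable at 0, where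
  its value is the total mass 1.\<close>

lemma rational_laplace_density_linear_bound:
  assumes "rational_laplace_density f N \<alpha> n Q"
  shows "\<exists>C. \<forall>\<^sub>F r in at_right 0. 1 - (\<integral>x. exp (- r * x) * f x \<partial>lborel) \<le> C * r"
proof -
  define P where "P = (\<Prod>i=1..N. [:\<alpha> i, 1:] ^ n i)"
  have P: "poly P r = (\<Prod>i=1..N. (\<alpha> i + r) ^ n i)" for r by (simp add: P_def poly_prod poly_power)
  have "poly P 0 \<noteq> 0" using assms unfolding P by (auto simp: rational_laplace_density_def)
  then have "((\<lambda>r. poly Q r / poly P r) has_real_derivative
      (poly (pderiv Q) 0 * poly P 0 - poly Q 0 * poly (pderiv P) 0) / (poly P 0 * poly P 0)) (at 0)"
    by (intro DERIV_divide poly_DERIV)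
  then obtain d where "((\<lambda>r. poly Q r / poly P r) has_real_derivative d) (at 0)" by blast
  then have "((\<lambda>r. (poly Q r / poly P r - poly Q 0 / poly P 0) / (r - 0)) \<longlongrightarrow> d) (at 0)"
    by (simp add: has_field_derivative_iff)
  then have "((\<lambda>r. (poly Q r / poly P r - poly Q 0 / poly P 0) / (r - 0)) \<longlongrightarrow> d) (at_right 0)"
    by (rule filterlim_mono[OF _ order_refl at_le]) simp
  \<comment> \<open>Any number below the derivative \<open>d\<close> would do. The transform
    eventually exceeds \<open>1 + (d - 1) * r\<close>, whence the constant
    \<open>1 - d\<close>.\<close>
  then have "\<forall>\<^sub>F r in at_right 0. d - 1 < (poly Q r / poly P r - poly Q 0 / poly P 0) / (r - 0)"
    by (rule order_tendstoD) simp
  moreover have "\<forall>\<^sub>F r in at_right (0::real). r > 0" by (auto simp: eventually_at_filter)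
  ultimately have "\<forall>\<^sub>F r in at_right 0. 1 - (\<integral>x. exp (- r * x) * f x \<partial>lborel) \<le> (1 - d) * r"
  proof eventually_elim
    case (elim r)
    have laplace: "(\<integral>x. exp (- r * x) * f x \<partial>lborel) = poly Q r / poly P r" if "r \<ge> 0" for r
      using assms that by (simp add: rational_laplace_density_def P)
    have "poly Q 0 / poly P 0 = 1"
      using laplace[of 0] assms by (simp add: rational_laplace_density_def)
    then have "(d - 1) * r < poly Q r / poly P r - 1" using elim by (simp add: pos_less_divide_eq)
    moreover have "(\<integral>x. exp (- r * x) * f x \<partial>lborel) = poly Q r / poly P r" using elim by (intro laplace) simp
    ultimately show ?case by (simp add: algebra_simps)
  qed
  then show ?thesis by blast
qed

lemma (in prob_space) compound_poisson_rational_density: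
  assumes f: "rational_laplace_density f N \<alpha> n Q" and l: "l > 0"
    and cp: "compound_poisson M (density lborel (\<lambda>x. ennreal (l * f x))) Z" and t: "t \<ge> 0"
  shows "AE \<omega> in M. \<forall>t\<ge>0. 0 \<le> Z t \<omega>"
    and "\<exists>C. \<forall>\<^sub>F r in at_right 0. 1 - expectation (\<lambda>\<omega>. exp (- r * Z t \<omega>)) \<le> C * r"
proof -
  have [measurable]: "f \<in> borel_measurable borel" and f0: "\<And>x. 0 \<le> f x" "\<And>x. x \<le> 0 \<Longrightarrow> f x = 0" and f1: "(\<integral>x. f x \<partial>lborel) = 1"
    using f by (auto simp: rational_laplace_density_def)
  let ?\<nu> = "density lborel (\<lambda>x. ennreal (l * f x))"
  have pos: "emeasure ?\<nu> {..0} = 0"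
    by (subst emeasure_density) (auto simp: f0 nn_integral_0_iff_AE split: split_indicator)
  show nonneg: "AE \<omega> in M. \<forall>t\<ge>0. 0 \<le> Z t \<omega>"
    by (rule compound_poisson_nonneg[OF cp pos])
  have [measurable]: "Z t \<in> borel_measurable M"
    using cp t by (simp add: compound_poisson_def levy_process_def)
  have Zt: "AE \<omega> in M. 0 \<le> Z t \<omega>" using nonneg t by (auto elim: eventually_mono)
  obtain m where m: "m \<ge> 0" "\<And>r. r \<ge> 0 \<Longrightarrow> (\<integral>\<^sup>+\<omega>. ennreal (1 - exp (- r * Z t \<omega>)) \<partial>M)
     \<le> ennreal m * (\<integral>\<^sup>+x. ennreal (1 - exp (- r * x)) \<partial>?\<nu>)"
    using compound_poisson_laplace_bound[OF cp pos t] by blast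
  \<comment> \<open>A nonintegrable function has Bochner integral 0, so the value 1 forces
    integrability.\<close>
  have int_f: "integrable lborel f" using f1 not_integrable_integral_eq by fastforce
  have le: "1 - expectation (\<lambda>\<omega>. exp (- r * Z t \<omega>)) \<le> m * l * (1 - (\<integral>x. exp (- r * x) * f x \<partial>lborel))"
    if r: "r \<ge> 0" for r
  proof -
    have int_ef: "integrable lborel (\<lambda>x. exp (- r * x) * f x)"
    proof (rule Bochner_Integration.integrable_bound[OF int_f])
      show "AE x in lborel. norm (exp (- r * x) * f x) \<le> norm (f x)"
      proof (rule AE_I2)
        fix x show "norm (exp (- r * x) * f x) \<le> norm (f x)"
          using f0 r by (cases "x \<le> 0") (auto simp: abs_mult mult_left_le_one_le)
      qed
    qed simp
    have int1: "integrable lborel (\<lambda>x. l * (f x - exp (- r * x) * f x))"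
      using int_f int_ef by (intro integrable_mult_right Bochner_Integration.integrable_diff)
    have "(\<integral>\<^sup>+x. ennreal (1 - exp (- r * x)) \<partial>?\<nu>) = (\<integral>\<^sup>+x. ennreal (l * (f x - exp (- r * x) * f x)) \<partial>lborel)"
    proof (subst nn_integral_density)
      show "(\<integral>\<^sup>+x. ennreal (l * f x) * ennreal (1 - exp (- r * x)) \<partial>lborel) = (\<integral>\<^sup>+x. ennreal (l * (f x - exp (- r * x) * f x)) \<partial>lborel)"
        using f0 l by (intro nn_integral_cong) (auto simp: ennreal_mult'[symmetric] algebra_simps)
    qed auto
    also have "\<dots> = ennreal (\<integral>x. l * (f x - exp (- r * x) * f x) \<partial>lborel)"
    proof (rule nn_integral_eq_integral[OF int1])
      have "exp (- r * x) * f x \<le> f x" for x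
        using f0 r by (cases "x \<le> 0") (auto simp: mult_left_le_one_le)
      then show "AE x in lborel. 0 \<le> l * (f x - exp (- r * x) * f x)" using l by simp
    qed
    also have "(\<integral>x. l * (f x - exp (- r * x) * f x) \<partial>lborel) = l * (1 - (\<integral>x. exp (- r * x) * f x \<partial>lborel))"
      using int_f int_ef f1 by simp
    finally have eq: "(\<integral>\<^sup>+x. ennreal (1 - exp (- r * x)) \<partial>?\<nu>) = \<dots>" .
    have int: "integrable M (\<lambda>\<omega>. exp (- r * Z t \<omega>))" using Zt r by (intro integrable_exp_uminus) auto
    have "ennreal (1 - expectation (\<lambda>\<omega>. exp (- r * Z t \<omega>))) = ennreal (expectation (\<lambda>\<omega>. 1 - exp (- r * Z t \<omega>)))"
      using int by (simp add: prob_space)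
    also have "\<dots> = (\<integral>\<^sup>+\<omega>. ennreal (1 - exp (- r * Z t \<omega>)) \<partial>M)"
      using int Zt r by (intro nn_integral_eq_integral[symmetric]) auto
    also have "\<dots> \<le> ennreal m * ennreal (l * (1 - (\<integral>x. exp (- r * x) * f x \<partial>lborel)))"
      using m(2)[OF r] unfolding eq .
    also have "\<dots> = ennreal (m * l * (1 - (\<integral>x. exp (- r * x) * f x \<partial>lborel)))"
      using m(1) by (simp add: ennreal_mult'[symmetric] mult.assoc)
    finally have en: "ennreal (1 - expectation (\<lambda>\<omega>. exp (- r * Z t \<omega>))) \<le> \<dots>" .
    have "(\<integral>x. exp (- r * x) * f x \<partial>lborel) \<le> (\<integral>x. f x \<partial>lborel)"
    proof (rule integral_mono[OF int_ef int_f])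
      show "exp (- r * x) * f x \<le> f x" for x
        using f0 r by (cases "x \<le> 0") (auto simp: mult_left_le_one_le)
    qed
    \<comment> \<open>\<open>ennreal\<close> sends negative reals to 0, so the inequality returns to
      the reals only with a nonnegative right side.\<close>
    then have "0 \<le> m * l * (1 - (\<integral>x. exp (- r * x) * f x \<partial>lborel))" using m l f1 by simp
    with en show ?thesis by (simp add: ennreal_le_iff)
  qed
  obtain C where C: "\<forall>\<^sub>F r in at_right 0. 1 - (\<integral>x. exp (- r * x) * f x \<partial>lborel) \<le> C * r"
    using rational_laplace_density_linear_bound[OF f] by blast
  moreover have "\<forall>\<^sub>F r in at_right (0::real). r > 0" by (auto simp: eventually_at_filter)
  ultimately have "\<forall>\<^sub>F r in at_right 0. 1 - expectation (\<lambda>\<omega>. exp (- r * Z t \<omega>)) \<le> (m * l * C) * r"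
  proof eventually_elim
    case (elim r)
    have "m * l * (1 - (\<integral>x. exp (- r * x) * f x \<partial>lborel)) \<le> m * l * (C * r)"
      using elim m l by (intro mult_left_mono) auto
    then show ?case using le[of r] elim by (simp add: mult.assoc)
  qed
  then show "\<exists>C. \<forall>\<^sub>F r in at_right 0. 1 - expectation (\<lambda>\<omega>. exp (- r * Z t \<omega>)) \<le> C * r" by blast
qed

section \<open>Tail of the running infimum\<close>

lemma exp_minus_sub_linear_le:
  fixes x :: real
  assumes "x \<ge> 0"
  shows "exp (- x) - 1 + x \<le> min (x\<^sup>2) x"
proof -
  have "1 + x \<le> exp x" by (rule exp_ge_add_one_self)
  then have "exp (- x) \<le> 1 / (1 + x)" using assms by (simp add: exp_minus field_simps)
  also have "1 / (1 + x) \<le> 1 - x + x\<^sup>2"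
  proof -
    \<comment> \<open>The product equals \<open>1 + x ^ 3\<close>.\<close>
    have "1 \<le> (1 - x + x\<^sup>2) * (1 + x)"
      using zero_le_power[OF assms, of 3] by (simp add: algebra_simps power2_eq_square power3_eq_cube)
    then show ?thesis using assms by (simp add: pos_divide_le_eq)
  qed
  finally have "exp (- x) - 1 + x \<le> x\<^sup>2" by simp
  moreover have "exp (- x) \<le> 1" using assms by simp
  ultimately show ?thesis by simp
qed

text \<open>The truncation term is linear in \<open>r\<close>, so subtracting \<open>r\<close> times
  the integrand at 1 cancels it for any \<open>h\<close>. What remains is at most
  \<open>r * (exp (- x) - 1 + x)\<close>, by \<open>1 - exp (- r * x) \<le> r * x\<close>, and hence
  at most \<open>r * min (x\<^sup>2) x\<close>.\<close>

lemma levy_khintchine_integral_linear_bound: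
  assumes \<nu>: "positive_levy_measure \<nu>" and h: "truncation_function \<nu> h"
    and fin: "(\<integral>\<^sup>+x. ennreal (min (x\<^sup>2) x) \<partial>\<nu>) < \<infinity>"
  shows "\<exists>C. \<forall>r\<ge>0. (\<integral>x. 1 - exp (- r * x) - r * x * h x \<partial>\<nu>) \<le> C * r"
proof -
  have sets: "sets \<nu> = sets borel" and null: "emeasure \<nu> {..0} = 0"
    using \<nu> by (auto simp: positive_levy_measure_def)
  have "measurable \<nu> borel = (borel_measurable borel :: (real \<Rightarrow> real) set)"
    by (rule measurable_cong_sets[OF sets refl])
  then have m_meas: "(\<lambda>x. min (x\<^sup>2) x) \<in> borel_measurable \<nu>" by simp
  have pos: "AE x in \<nu>. 0 < x"
    by (rule AE_I'[of "{..0}"]) (auto simp: null_sets_def sets null)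
  have int_h: "integrable \<nu> (\<lambda>x. 1 - exp (- r * x) - r * x * h x)" if "r \<ge> 0" for r
    using h that by (auto simp: truncation_function_def)
  have int_m: "integrable \<nu> (\<lambda>x. min (x\<^sup>2) x)"
    using pos fin by (intro integrableI_nonneg m_meas) auto
  define C where "C = (\<integral>x. 1 - exp (- 1 * x) - 1 * x * h x \<partial>\<nu>) + (\<integral>x. min (x\<^sup>2) x \<partial>\<nu>)"
  have "(\<integral>x. 1 - exp (- r * x) - r * x * h x \<partial>\<nu>) \<le> C * r" if r: "r \<ge> 0" for r
  proof -
    have "(\<integral>x. 1 - exp (- r * x) - r * x * h x \<partial>\<nu>)
        \<le> (\<integral>x. r * (1 - exp (- 1 * x) - 1 * x * h x) + r * min (x\<^sup>2) x \<partial>\<nu>)"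
    proof (rule integral_mono_AE)
      show "AE x in \<nu>. 1 - exp (- r * x) - r * x * h x \<le> r * (1 - exp (- 1 * x) - 1 * x * h x) + r * min (x\<^sup>2) x"
        using pos
      proof eventually_elim
        case (elim x)
        have "1 - exp (- r * x) \<le> r * x" using exp_ge_add_one_self[of "- r * x"] by simp
        moreover have "r * (exp (- x) - 1 + x) \<le> r * min (x\<^sup>2) x"
          using elim r by (intro mult_left_mono exp_minus_sub_linear_le) auto
        ultimately show ?case by (simp add: algebra_simps)
      qed
    qed (use int_h[OF r] int_h[of 1] int_m in auto)
    also have "\<dots> = r * (\<integral>x. 1 - exp (- 1 * x) - 1 * x * h x \<partial>\<nu>) + r * (\<integral>x. min (x\<^sup>2) x \<partial>\<nu>)"
      using int_h[of 1] int_m by (subst Bochner_Integration.integral_add) auto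
    also have "\<dots> = C * r" by (simp add: C_def algebra_simps)
    finally show ?thesis .
  qed
  then show ?thesis by blast
qed

text \<open>This excludes Case C and the compound Poisson alternative of Case A, in which the exponent
  of \<open>S\<close> is \<open>O(r)\<close>.\<close>

lemma regularly_varying_not_linear_bound:
  fixes g :: "real \<Rightarrow> real"
  assumes lim: "((\<lambda>r. r powr (- \<xi>) * g r) \<longlongrightarrow> D) (at_right 0)"
    and xi: "\<xi> < 1" and D: "D > 0" and bound: "\<forall>\<^sub>F r in at_right 0. g r \<le> C * r"
  shows False
proof -
  have "((\<lambda>r::real. C * r powr (1 - \<xi>)) \<longlongrightarrow> C * 0 powr (1 - \<xi>)) (at_right 0)"
    using xi by (intro tendsto_intros) (auto simp: eventually_at_filter)
  moreover have "\<forall>\<^sub>F r in at_right (0::real). r > 0" by (auto simp: eventually_at_filter)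
  with bound have "\<forall>\<^sub>F r in at_right 0. r powr (- \<xi>) * g r \<le> C * r powr (1 - \<xi>)"
  proof eventually_elim
    case (elim r)
    have "r powr (- \<xi>) * g r \<le> r powr (- \<xi>) * (C * r)" using elim by (intro mult_left_mono) auto
    also have "\<dots> = C * r powr (1 - \<xi>)" using elim by (simp add: powr_diff powr_minus field_simps)
    finally show ?case .
  qed
  ultimately have "D \<le> C * 0 powr (1 - \<xi>)"
    using lim by (intro tendsto_le[OF trivial_limit_at_right_real]) 
  with D show False by simp
qed

lemma tendsto_powr_one_minus_exp:
  fixes \<Psi> :: "real \<Rightarrow> real"
  assumes lim: "((\<lambda>r. r powr (- \<xi>) * \<Psi> r) \<longlongrightarrow> D) (at_right 0)" and xi: "\<xi> > 0"
  shows "((\<lambda>r. r powr (- \<xi>) * (1 - exp (- t * \<Psi> r))) \<longlongrightarrow> t * D) (at_right 0)"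
proof -
  have "((\<lambda>r::real. r powr \<xi>) \<longlongrightarrow> 0 powr \<xi>) (at_right 0)"
    using xi by (intro tendsto_intros) (auto simp: eventually_at_filter)
  then have "((\<lambda>r. r powr \<xi> * (r powr (- \<xi>) * \<Psi> r)) \<longlongrightarrow> 0 powr \<xi> * D) (at_right 0)"
    by (intro tendsto_mult lim)
  moreover have "\<forall>\<^sub>F r in at_right 0. r powr \<xi> * (r powr (- \<xi>) * \<Psi> r) = \<Psi> r"
    by (auto simp: eventually_at_filter powr_minus)
  ultimately have \<Psi>0: "(\<Psi> \<longlongrightarrow> 0) (at_right 0)" using Lim_transform_eventually by fastforce
  \<comment> \<open>The difference quotient of \<open>1 - exp (- t * y)\<close> at 0, extended
    continuously by its derivative \<open>t\<close>; this covers points where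
    \<open>\<Psi> r = 0\<close>.\<close>
  define F where "F = (\<lambda>y. if y = 0 then t else (1 - exp (- t * y)) / y)"
  have "((\<lambda>y. 1 - exp (- t * y)) has_real_derivative t) (at 0)"
    by (auto intro!: derivative_eq_intros)
  then have "((\<lambda>y. (1 - exp (- t * y)) / y) \<longlongrightarrow> t) (at 0)"
    by (simp add: has_field_derivative_iff)
  then have "(F \<longlongrightarrow> t) (at 0)"
    by (rule Lim_transform_eventually) (auto simp: eventually_at_filter F_def)
  then have "isCont F 0" by (simp add: isCont_def F_def)
  then have "((\<lambda>r. F (\<Psi> r)) \<longlongrightarrow> F 0) (at_right 0)" by (rule isCont_tendsto_compose[OF _ \<Psi>0])
  then have "((\<lambda>r. r powr (- \<xi>) * \<Psi> r * F (\<Psi> r)) \<longlongrightarrow> D * t) (at_right 0)"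
    by (intro tendsto_mult lim) (simp add: F_def)
  moreover have "r powr (- \<xi>) * \<Psi> r * F (\<Psi> r) = r powr (- \<xi>) * (1 - exp (- t * \<Psi> r))" for r
    by (simp add: F_def)
  ultimately show ?thesis by (simp only: mult.commute)
qed

section \<open>Tails at fixed times and at the exponential time\<close>

text \<open>Markov's bound at \<open>r = 1 / (a * u)\<close> makes the tail at most
  \<open>K / u\<close>, which is negligible against \<open>u powr - \<xi>\<close> because
  \<open>\<xi> < 1\<close>.\<close>

lemma (in prob_space) tail_negligible_of_linear_laplace_bound:
  fixes Y :: "'a \<Rightarrow> real"
  assumes [measurable]: "Y \<in> borel_measurable M" and nonneg: "AE \<omega> in M. 0 \<le> Y \<omega>"
    and bound: "\<forall>\<^sub>F r in at_right 0. 1 - expectation (\<lambda>\<omega>. exp (- r * Y \<omega>)) \<le> C * r"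
    and xi: "\<xi> < 1" and a: "a > 0"
  shows "((\<lambda>u. u powr \<xi> * prob {\<omega>\<in>space M. a * u < Y \<omega>}) \<longlongrightarrow> 0) at_top"
proof -
  define K where "K = C / a / (1 - exp (- 1))"
  have "filterlim (\<lambda>u. inverse (a * u)) (at_right 0) at_top"
    using a by (intro filterlim_compose[OF filterlim_inverse_at_right_top]
      filterlim_tendsto_pos_mult_at_top[OF tendsto_const]) (auto simp: filterlim_ident)
  then have "\<forall>\<^sub>F u in at_top. 1 - expectation (\<lambda>\<omega>. exp (- (inverse (a * u)) * Y \<omega>)) \<le> C * inverse (a * u)"
    using bound by (auto simp: filterlim_iff)
  then have upper: "\<forall>\<^sub>F u in at_top. u powr \<xi> * prob {\<omega>\<in>space M. a * u < Y \<omega>} \<le> K * u powr (\<xi> - 1)"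
    using eventually_gt_at_top[of 0]
  proof eventually_elim
    case (elim u)
    have "prob {\<omega>\<in>space M. a * u < Y \<omega>} \<le> (1 - expectation (\<lambda>\<omega>. exp (- (1 / (a * u)) * Y \<omega>))) / (1 - exp (- 1))"
      using elim a by (intro tail_le_laplace_transform nonneg) auto
    also have "\<dots> \<le> (C * inverse (a * u)) / (1 - exp (- 1))"
      using elim by (intro divide_right_mono) (auto simp: inverse_eq_divide)
    also have "\<dots> = K / u" using elim a by (simp add: K_def field_simps)
    finally have "u powr \<xi> * prob {\<omega>\<in>space M. a * u < Y \<omega>} \<le> u powr \<xi> * (K / u)"
      by (intro mult_left_mono) auto
    also have "\<dots> = K * u powr (\<xi> - 1)" using elim by (simp add: powr_diff)
    finally show ?case .
  qed
  have lim: "((\<lambda>u. K * u powr (\<xi> - 1)) \<longlongrightarrow> K * 0) at_top"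
    using xi by (intro tendsto_mult tendsto_const tendsto_neg_powr filterlim_ident) auto
  show ?thesis
  proof (rule tendsto_sandwich)
    show "\<forall>\<^sub>F u in at_top. 0 \<le> u powr \<xi> * prob {\<omega>\<in>space M. a * u < Y \<omega>}"
      by (intro always_eventually) simp
    show "((\<lambda>u. K * u powr (\<xi> - 1)) \<longlongrightarrow> 0) at_top" using lim by simp
  qed (rule upper, simp)
qed

text \<open>From above: if \<open>X s < - u\<close> for some \<open>s \<le> t\<close>, then
  \<open>S t \<ge> S s > u + Y s \<ge> u\<close>. From below, time \<open>t\<close> alone suffices:
  \<open>S t > a * u\<close> and \<open>Y t \<le> (a - 1) * u\<close> give \<open>X t < - u\<close>,
  and a union bound splits off the large values of \<open>Y t\<close>.\<close>

lemma (in prob_space) running_inf_tail_at_fixed_time: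
  assumes X: "\<And>t. t \<ge> 0 \<Longrightarrow> X t \<in> borel_measurable M"
    and paths: "\<And>\<omega>. \<omega> \<in> space M \<Longrightarrow> cadlag (\<lambda>t. X t \<omega>)"
    and S: "\<And>t. t \<ge> 0 \<Longrightarrow> S t \<in> borel_measurable M" and mono: "AE \<omega> in M. mono_on {0..} (\<lambda>t. S t \<omega>)"
    and Y: "\<And>t. t \<ge> 0 \<Longrightarrow> Y t \<in> borel_measurable M" and Y0: "AE \<omega> in M. \<forall>t\<ge>0. 0 \<le> Y t \<omega>"
    and X_eq: "\<And>t \<omega>. X t \<omega> = Y t \<omega> - S t \<omega>" and t: "t \<ge> 0"
    and S_tail: "((\<lambda>u. u powr \<xi> * prob {\<omega>\<in>space M. u < S t \<omega>}) \<longlongrightarrow> L) at_top"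
    and Y_tail: "\<And>a. a > 0 \<Longrightarrow> ((\<lambda>u. u powr \<xi> * prob {\<omega>\<in>space M. a * u < Y t \<omega>}) \<longlongrightarrow> 0) at_top"
  shows "\<And>u. prob {\<omega>\<in>space M. running_inf X t \<omega> < - u} \<le> prob {\<omega>\<in>space M. u < S t \<omega>}" (is "\<And>u. ?upper u")
    and "((\<lambda>u. u powr \<xi> * prob {\<omega>\<in>space M. running_inf X t \<omega> < - u}) \<longlongrightarrow> L) at_top" (is ?lim)
proof -
  have [measurable]: "S t \<in> borel_measurable M" "Y t \<in> borel_measurable M" using S Y t by auto
  have [measurable]: "{\<omega>\<in>space M. running_inf X t \<omega> < a} \<in> sets M" for a
    by (rule running_inf_sets) (use X paths t in auto)
  have iff: "running_inf X t \<omega> < a \<longleftrightarrow> (\<exists>s\<in>{0..t}. X s \<omega> < a)" if "\<omega> \<in> space M" for \<omega> a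
    using running_inf_less_iff[of X \<omega> t a, OF paths[OF that] t] .
  show upper: "?upper u" for u
  proof (rule finite_measure_mono_AE)
    show "AE \<omega> in M. \<omega> \<in> {\<omega>\<in>space M. running_inf X t \<omega> < - u} \<longrightarrow> \<omega> \<in> {\<omega>\<in>space M. u < S t \<omega>}"
      using mono Y0
    proof eventually_elim
      case (elim \<omega>)
      show ?case
      proof
        assume "\<omega> \<in> {\<omega>\<in>space M. running_inf X t \<omega> < - u}"
        then obtain s where \<omega>: "\<omega> \<in> space M" and s: "s \<in> {0..t}" "X s \<omega> < - u" using iff by blast
        have "S s \<omega> \<le> S t \<omega>" using monotone_onD[OF elim(1), of s t] s t by auto
        moreover have "0 \<le> Y s \<omega>" using elim(2) s by auto
        ultimately show "\<omega> \<in> {\<omega>\<in>space M. u < S t \<omega>}" using s(2) \<omega> by (simp add: X_eq)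
      qed
    qed
  qed measurable
  have lower: "prob {\<omega>\<in>space M. a * u < S t \<omega>} - prob {\<omega>\<in>space M. (a - 1) * u < Y t \<omega>}
      \<le> prob {\<omega>\<in>space M. running_inf X t \<omega> < - u}" for a u
  proof -
    have "prob {\<omega>\<in>space M. a * u < S t \<omega>}
      \<le> prob ({\<omega>\<in>space M. running_inf X t \<omega> < - u} \<union> {\<omega>\<in>space M. (a - 1) * u < Y t \<omega>})"
    proof (rule finite_measure_mono)
      show "{\<omega>\<in>space M. a * u < S t \<omega>} \<subseteq> {\<omega>\<in>space M. running_inf X t \<omega> < - u} \<union> {\<omega>\<in>space M. (a - 1) * u < Y t \<omega>}"
      proof
        fix \<omega> assume \<omega>: "\<omega> \<in> {\<omega>\<in>space M. a * u < S t \<omega>}"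
        show "\<omega> \<in> {\<omega>\<in>space M. running_inf X t \<omega> < - u} \<union> {\<omega>\<in>space M. (a - 1) * u < Y t \<omega>}"
        proof (cases "(a - 1) * u < Y t \<omega>")
          case False
          then have "X t \<omega> < - u" using \<omega> by (simp add: X_eq algebra_simps)
          then show ?thesis using \<omega> t by (auto simp: iff intro!: bexI[of _ t])
        qed (use \<omega> in auto)
      qed
    qed measurable
    also have "\<dots> \<le> prob {\<omega>\<in>space M. running_inf X t \<omega> < - u} + prob {\<omega>\<in>space M. (a - 1) * u < Y t \<omega>}"
      by (intro measure_Un_le) measurable
    finally show ?thesis by simp
  qed
  \<comment> \<open>Passing from \<open>u\<close> to \<open>a * u\<close> costs the factor
    \<open>a powr - \<xi>\<close>, which is removed below by choosing \<open>a\<close> close to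
    1.\<close>
  have lower_lim: "((\<lambda>u. u powr \<xi> * (prob {\<omega>\<in>space M. a * u < S t \<omega>} - prob {\<omega>\<in>space M. (a - 1) * u < Y t \<omega>}))
     \<longlongrightarrow> a powr - \<xi> * L) at_top" if a: "a > 1" for a
  proof -
    have "filterlim (\<lambda>u. a * u) at_top at_top"
      using a by (intro filterlim_tendsto_pos_mult_at_top[OF tendsto_const]) (auto simp: filterlim_ident)
    then have "((\<lambda>u. (a * u) powr \<xi> * prob {\<omega>\<in>space M. a * u < S t \<omega>}) \<longlongrightarrow> L) at_top"
      by (rule filterlim_compose[OF S_tail])
    then have "((\<lambda>u. a powr - \<xi> * ((a * u) powr \<xi> * prob {\<omega>\<in>space M. a * u < S t \<omega>})
       - u powr \<xi> * prob {\<omega>\<in>space M. (a - 1) * u < Y t \<omega>}) \<longlongrightarrow> a powr - \<xi> * L - 0) at_top"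
      using a by (intro tendsto_diff tendsto_mult_left Y_tail) auto
    moreover have "\<forall>\<^sub>F u in at_top. a powr - \<xi> * ((a * u) powr \<xi> * prob {\<omega>\<in>space M. a * u < S t \<omega>})
         - u powr \<xi> * prob {\<omega>\<in>space M. (a - 1) * u < Y t \<omega>}
       = u powr \<xi> * (prob {\<omega>\<in>space M. a * u < S t \<omega>} - prob {\<omega>\<in>space M. (a - 1) * u < Y t \<omega>})"
      using eventually_gt_at_top[of 0]
      by eventually_elim (use a in \<open>simp add: powr_mult powr_minus right_diff_distrib\<close>)
    ultimately show ?thesis using Lim_transform_eventually by fastforce
  qed
  show ?lim
  proof (rule order_tendstoI)
    fix b assume b: "b < L"
    have "((\<lambda>a::real. a powr - \<xi> * L) \<longlongrightarrow> 1 powr - \<xi> * L) (at_right 1)"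
      by (intro tendsto_intros) auto
    then have "\<forall>\<^sub>F a in at_right 1. b < a powr - \<xi> * L" using b by (auto dest: order_tendstoD(1))
    then have "\<forall>\<^sub>F a in at_right (1::real). b < a powr - \<xi> * L \<and> 1 < a"
      by (intro eventually_conj) (auto simp: eventually_at_filter)
    then obtain a :: real where a: "b < a powr - \<xi> * L" "1 < a"
      using eventually_happens'[OF trivial_limit_at_right_real] by blast
    have "\<forall>\<^sub>F u in at_top. b < u powr \<xi> * (prob {\<omega>\<in>space M. a * u < S t \<omega>} - prob {\<omega>\<in>space M. (a - 1) * u < Y t \<omega>})"
      by (rule order_tendstoD(1)[OF lower_lim[OF a(2)] a(1)])
    then show "\<forall>\<^sub>F u in at_top. b < u powr \<xi> * prob {\<omega>\<in>space M. running_inf X t \<omega> < - u}"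
      by eventually_elim (erule less_le_trans, intro mult_left_mono lower, simp)
  next
    fix b assume "L < b"
    with S_tail have "\<forall>\<^sub>F u in at_top. u powr \<xi> * prob {\<omega>\<in>space M. u < S t \<omega>} < b" by (rule order_tendstoD)
    then show "\<forall>\<^sub>F u in at_top. u powr \<xi> * prob {\<omega>\<in>space M. running_inf X t \<omega> < - u} < b"
      by eventually_elim (erule le_less_trans[rotated], intro mult_left_mono upper, simp)
  qed
qed

text \<open>The limits are linear in \<open>t\<close>, so averaging replaces \<open>t\<close> by the
  mean \<open>1 / q\<close>. In \<open>bound\<close> the quantifier over \<open>t\<close> stands
  inside the one over large \<open>u\<close>, as domination by the integrable function
  \<open>K * \<bar>t\<bar>\<close> demands.\<close>

lemma (in prob_space) running_inf_tail_at_exponential_time: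
  assumes X: "\<And>t. t \<ge> 0 \<Longrightarrow> X t \<in> borel_measurable M"
    and paths: "\<And>\<omega>. \<omega> \<in> space M \<Longrightarrow> cadlag (\<lambda>t. X t \<omega>)"
    and indep: "indep_set (process_events M {0..} X) (process_events M UNIV (\<lambda>_::unit. e))"
    and e: "distributed M lborel e (exponential_density q)" and q: "q > 0"
    and lim: "\<And>t. t \<ge> 0 \<Longrightarrow>
      ((\<lambda>u. u powr \<xi> * prob {\<omega>\<in>space M. running_inf X t \<omega> < - u}) \<longlongrightarrow> t * L) at_top"
    and bound: "\<forall>\<^sub>F u in at_top. \<forall>t\<ge>0. u powr \<xi> * prob {\<omega>\<in>space M. running_inf X t \<omega> < - u} \<le> K * t"
  shows "((\<lambda>u. u powr \<xi> * prob {\<omega>\<in>space M. running_inf X (e \<omega>) \<omega> < - u}) \<longlongrightarrow> L / q) at_top"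
proof -
  have [measurable]: "e \<in> borel_measurable M" using distributed_measurable[OF e] by simp
  have e0: "AE \<omega> in M. 0 \<le> e \<omega>"
    by (subst distributed_AE2[OF e]) (auto simp: exponential_density_def)
  have Ee: "expectation e = 1 / q" by (rule exponential_distributed_expectation[OF q e])
  \<comment> \<open>The nonzero mean excludes the default value 0 of a nonintegrable
    function.\<close>
  have int_e: "integrable M e"
    by (rule ccontr) (use Ee q not_integrable_integral_eq[of M e] in simp)
  define E where "E = distr M borel e"
  define p where "p = (\<lambda>u t. indicator {0..} t * prob {\<omega>\<in>space M. running_inf X t \<omega> < - u})"
  have p_meas[measurable]: "p u \<in> borel_measurable borel" for u
    unfolding p_def by (rule prob_running_inf_at_independent_time[OF X paths indep _ e0]) measurable
  have p_eq: "prob {\<omega>\<in>space M. running_inf X (e \<omega>) \<omega> < - u} = (\<integral>t. p u t \<partial>E)" for u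
    unfolding p_def E_def by (rule prob_running_inf_at_independent_time[OF X paths indep _ e0]) measurable
  have "((\<lambda>u. \<integral>t. u powr \<xi> * p u t \<partial>E) \<longlongrightarrow> (\<integral>t. indicator {0..} t * (t * L) \<partial>E)) at_top"
  proof (rule integral_dominated_convergence_at_top[where w="\<lambda>t. K * \<bar>t\<bar>"])
    show "integrable E (\<lambda>t. K * \<bar>t\<bar>)"
      unfolding E_def using int_e by (subst integrable_distr_eq) auto
    show "AE t in E. ((\<lambda>u. u powr \<xi> * p u t) \<longlongrightarrow> indicator {0..} t * (t * L)) at_top"
      using lim by (intro AE_I2) (auto simp: p_def split: split_indicator)
    show "\<forall>\<^sub>F u in at_top. AE t in E. norm (u powr \<xi> * p u t) \<le> K * \<bar>t\<bar>"
      using bound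
    proof eventually_elim
      case (elim u)
      have "AE t in E. 0 \<le> t" unfolding E_def using e0 by (subst AE_distr_iff) auto
      then show ?case
        by eventually_elim (use elim in \<open>simp add: p_def abs_mult\<close>)
    qed
  qed (simp_all add: E_def)
  also have "(\<integral>t. indicator {0..} t * (t * L) \<partial>E) = expectation (\<lambda>\<omega>. indicator {0..} (e \<omega>) * (e \<omega> * L))"
    unfolding E_def by (intro integral_distr) measurable
  also have "\<dots> = expectation (\<lambda>\<omega>. L * e \<omega>)"
  proof (rule integral_cong_AE)
    show "AE \<omega> in M. indicator {0..} (e \<omega>) * (e \<omega> * L) = L * e \<omega>"
      using e0 by eventually_elim simp
  qed measurable
  also have "\<dots> = L / q" using Ee by simp
  finally show ?thesis by (simp add: p_eq)
qed

section \<open>Transforms at time 1 when the mean is finite\<close>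

text \<open>Counterpart of \<open>levy_laplace_transform\<close> at time 1 without a sign condition
  on \<open>S\<close>, for use while it is still open whether \<open>S\<close> is a
  subordinator.\<close>

lemma (in prob_space) laplace_transform_eq_exp_laplace_exponent:
  assumes "integrable M (\<lambda>\<omega>. exp (- r * S 1 \<omega>))"
  shows "expectation (\<lambda>\<omega>. exp (- r * S 1 \<omega>)) = exp (- laplace_exponent M S r)"
proof -
  have "expectation (\<lambda>\<omega>. exp (- r * S 1 \<omega>)) \<ge> 0" by (intro integral_nonneg_AE) auto
  moreover have "0 \<noteq> expectation (\<lambda>\<omega>. exp (- r * S 1 \<omega>))"
    unfolding eq_commute[of 0] using assms by (subst integral_nonneg_eq_0_iff_AE) (auto simp: AE_False)
  ultimately have "expectation (\<lambda>\<omega>. exp (- r * S 1 \<omega>)) > 0" by linarith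
  then show ?thesis unfolding laplace_exponent_def by (simp only: exp_ln minus_minus)
qed

text \<open>Only the difference is known to be integrable. Factor \<open>exp (- r * S)\<close> as
  \<open>exp (- r * Z) * exp (r * (Z - S))\<close>; the first factor is at most 1 and
  \<open>1 - exp (r * x) \<le> r * \<bar>x\<bar>\<close>, so passing from \<open>Z\<close> to
  \<open>S\<close> adds at most \<open>r * \<bar>Z - S\<bar>\<close>.\<close>

lemma (in prob_space) one_minus_laplace_linear_bound_of_integrable_difference:
  fixes S Z :: "'a \<Rightarrow> real"
  assumes [measurable]: "Z \<in> borel_measurable M" and Z0: "AE \<omega> in M. 0 \<le> Z \<omega>"
    and Z: "\<forall>\<^sub>F r in at_right 0. 1 - expectation (\<lambda>\<omega>. exp (- r * Z \<omega>)) \<le> C * r"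
    and S: "\<And>r. r \<ge> 0 \<Longrightarrow> integrable M (\<lambda>\<omega>. exp (- r * S \<omega>))"
    and diff: "integrable M (\<lambda>\<omega>. Z \<omega> - S \<omega>)"
  shows "\<forall>\<^sub>F r in at_right 0. 1 - expectation (\<lambda>\<omega>. exp (- r * S \<omega>)) \<le> (C + expectation (\<lambda>\<omega>. \<bar>Z \<omega> - S \<omega>\<bar>)) * r"
proof -
  have "\<forall>\<^sub>F r in at_right (0::real). r > 0" by (auto simp: eventually_at_filter)
  with Z show ?thesis
  proof eventually_elim
    case (elim r)
    have intZ: "integrable M (\<lambda>\<omega>. exp (- r * Z \<omega>))" using Z0 elim by (intro integrable_exp_uminus) auto
    have intS: "integrable M (\<lambda>\<omega>. exp (- r * S \<omega>))" using S elim by simp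
    have "expectation (\<lambda>\<omega>. 1 - exp (- r * S \<omega>)) \<le> expectation (\<lambda>\<omega>. (1 - exp (- r * Z \<omega>)) + r * \<bar>Z \<omega> - S \<omega>\<bar>)"
    proof (rule integral_mono_AE)
      show "AE \<omega> in M. 1 - exp (- r * S \<omega>) \<le> (1 - exp (- r * Z \<omega>)) + r * \<bar>Z \<omega> - S \<omega>\<bar>"
        using Z0
      proof eventually_elim
        case z: (elim \<omega>)
        define x where "x = Z \<omega> - S \<omega>"
        have "exp (- r * Z \<omega>) * (1 - exp (r * x)) \<le> exp (- r * Z \<omega>) * (r * \<bar>x\<bar>)"
        proof (rule mult_left_mono)
          have "1 - exp (r * x) \<le> - (r * x)" using exp_ge_add_one_self[of "r * x"] by linarith
          also have "\<dots> \<le> \<bar>r * x\<bar>" by simp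
          also have "\<dots> = r * \<bar>x\<bar>" using elim by (simp add: abs_mult)
          finally show "1 - exp (r * x) \<le> r * \<bar>x\<bar>" .
        qed simp
        also have "\<dots> \<le> 1 * (r * \<bar>x\<bar>)" using elim z by (intro mult_right_mono) auto
        finally have "exp (- r * Z \<omega>) - exp (- r * Z \<omega>) * exp (r * x) \<le> r * \<bar>x\<bar>"
          by (simp add: right_diff_distrib)
        moreover have "exp (- r * Z \<omega>) * exp (r * x) = exp (- r * S \<omega>)"
          by (simp add: x_def exp_add[symmetric] algebra_simps)
        ultimately show ?case by (simp add: x_def)
      qed
    qed (use intZ intS diff in auto)
    also have "\<dots> = (1 - expectation (\<lambda>\<omega>. exp (- r * Z \<omega>))) + r * expectation (\<lambda>\<omega>. \<bar>Z \<omega> - S \<omega>\<bar>)"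
      using intZ diff by (simp add: prob_space)
    also have "\<dots> \<le> (C + expectation (\<lambda>\<omega>. \<bar>Z \<omega> - S \<omega>\<bar>)) * r" using elim by (simp add: algebra_simps)
    finally show ?case using intS by (simp add: prob_space)
  qed
qed

section \<open>The limit theorem\<close>

theorem proposition1:
  fixes M :: "'a measure"
    and B Z S X :: "real \<Rightarrow> 'a \<Rightarrow> real"
    and e :: "'a \<Rightarrow> real"
    and \<nu> :: "real measure"
    and h f1 :: "real \<Rightarrow> real"
    and c \<gamma> lambda1 q \<xi> D :: real
    and N :: nat and \<alpha> :: "nat \<Rightarrow> real" and n :: "nat \<Rightarrow> nat" and Q :: "real poly"
  assumes "prob_space M"
    and "c \<ge> 0" and "\<gamma> \<ge> 0" and "lambda1 > 0"
    and "brownian_motion M 2 B"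
    and "rational_laplace_density f1 N \<alpha> n Q"
    and "compound_poisson M (density lborel (\<lambda>x. ennreal (lambda1 * f1 x))) Z"
    and "spectrally_positive_pure_jump M \<nu> h S"
    and "indep_processes M [B, Z, S]"
    and X_def: "X = total_process c \<gamma> B Z S"
    and "case_A M \<nu> c \<gamma> S X \<or> case_B M \<nu> c \<gamma> S \<or> case_C M \<nu> c \<gamma> S X"
    and "q > 0"
    and "distributed M lborel e (exponential_density q)"
    and "prob_space.indep_set M (process_events M {0..} X) (process_events M UNIV (\<lambda>_::unit. e))"
    and "0 < \<xi>" and "\<xi> < 1" and "D > 0"
    and "((\<lambda>r. r powr (- \<xi>) * laplace_exponent M S r) \<longlongrightarrow> D) (at_right 0)"
  shows "((\<lambda>u. measure M {\<omega>\<in>space M. running_inf X (e \<omega>) \<omega> < - u} / u powr (- \<xi>))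
           \<longlongrightarrow> D / (q * Gamma (1 - \<xi>))) at_top"
proof -
  interpret prob_space M by fact
  have c: "c \<ge> 0" using assms by simp
  have xi: "0 < \<xi>" "\<xi> < 1" and D: "D > 0" and q: "q > 0" using assms by auto
  note f1 = \<open>rational_laplace_density f1 N \<alpha> n Q\<close>
  note Z_cp = \<open>compound_poisson M (density lborel (\<lambda>x. ennreal (lambda1 * f1 x))) Z\<close>
  note Z_rational = compound_poisson_rational_density[OF f1 \<open>lambda1 > 0\<close> Z_cp]
  have SP: "levy_process M S" "positive_levy_measure \<nu>" "truncation_function \<nu> h"
    and S_exp_int: "\<And>r. r \<ge> 0 \<Longrightarrow> integrable M (\<lambda>\<omega>. exp (- r * S 1 \<omega>))"
    and S_exponent: "\<And>r. r \<ge> 0 \<Longrightarrow> laplace_exponent M S r = (\<integral>x. 1 - exp (- r * x) - r * x * h x \<partial>\<nu>)"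
    using \<open>spectrally_positive_pure_jump M \<nu> h S\<close> by (auto simp: spectrally_positive_pure_jump_def)
  have levy_B: "levy_process M B" and levy_Z: "levy_process M Z"
    using \<open>brownian_motion M 2 B\<close> Z_cp by (auto simp: brownian_motion_def compound_poisson_def)
  have meas: "B t \<in> borel_measurable M" "Z t \<in> borel_measurable M" "S t \<in> borel_measurable M" if "t \<ge> 0" for t
    using levy_B levy_Z SP(1) that by (auto simp: levy_process_def)
  have X_meas: "X t \<in> borel_measurable M" if "t \<ge> 0" for t
    unfolding X_def total_process_def[abs_def] using meas[OF that] by measurable
  have X_paths: "cadlag (\<lambda>t. X t \<omega>)" if "\<omega> \<in> space M" for \<omega>
    unfolding X_def using levy_B levy_Z SP(1) that
    by (intro cadlag_total_process) (auto simp: levy_process_def)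
  note \<Psi>_lim = \<open>((\<lambda>r. r powr (- \<xi>) * laplace_exponent M S r) \<longlongrightarrow> D) (at_right 0)\<close>
  have not_linear: "\<not> (\<forall>\<^sub>F r in at_right 0. laplace_exponent M S r \<le> C * r)" for C
    using regularly_varying_not_linear_bound[OF \<Psi>_lim xi(2) D] by blast
  have Z0: "AE \<omega> in M. \<forall>t\<ge>0. 0 \<le> Z t \<omega>" by (rule Z_rational(1)[of 0]) simp
  have subordinator: "\<gamma> = 0 \<and> driftless_subordinator M \<nu> S"
    using \<open>case_A M \<nu> c \<gamma> S X \<or> case_B M \<nu> c \<gamma> S \<or> case_C M \<nu> c \<gamma> S X\<close>
  proof (elim disjE)
    assume A: "case_A M \<nu> c \<gamma> S X"
    have "\<not> (\<integral>\<omega>. X 1 \<omega> \<partial>M) > 0"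
    proof
      assume mean: "(\<integral>\<omega>. X 1 \<omega> \<partial>M) > 0"
      \<comment> \<open>A positive Bochner integral cannot be the default value 0, so the mean is
        finite; since \<open>c = \<gamma> = 0\<close>, \<open>X 1\<close> is
        \<open>Z 1 - S 1\<close>.\<close>
      have "integrable M (X 1)"
        by (rule ccontr) (use mean not_integrable_integral_eq[of M "X 1"] in simp)
      then have diff: "integrable M (\<lambda>\<omega>. Z 1 \<omega> - S 1 \<omega>)"
        using A by (simp add: X_def total_process_def[abs_def] case_A_def)
      obtain C where C: "\<forall>\<^sub>F r in at_right 0. 1 - expectation (\<lambda>\<omega>. exp (- r * Z 1 \<omega>)) \<le> C * r"
        using Z_rational(2)[of 1] by auto
      have "AE \<omega> in M. 0 \<le> Z 1 \<omega>" using Z0 by eventually_elim simp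
      then have "\<forall>\<^sub>F r in at_right 0. 1 - expectation (\<lambda>\<omega>. exp (- r * S 1 \<omega>)) \<le> (C + expectation (\<lambda>\<omega>. \<bar>Z 1 \<omega> - S 1 \<omega>\<bar>)) * r"
        by (intro one_minus_laplace_linear_bound_of_integrable_difference meas C S_exp_int diff) auto
      moreover have "\<forall>\<^sub>F r in at_right (0::real). r > 0" by (auto simp: eventually_at_filter)
      ultimately have "\<forall>\<^sub>F r in at_right 0. 1 - exp (- 1 * laplace_exponent M S r) \<le> (C + expectation (\<lambda>\<omega>. \<bar>Z 1 \<omega> - S 1 \<omega>\<bar>)) * r"
        by eventually_elim (use laplace_transform_eq_exp_laplace_exponent[of _ S, OF S_exp_int] in simp)
      \<comment> \<open>The linear bound is on \<open>1 - exp (- \<Psi>)\<close> instead of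
        \<open>\<Psi>\<close>, which is no loss: times \<open>r powr (- \<xi>)\<close> it has the
        same limit \<open>D > 0\<close>.\<close>
      then show False
        using regularly_varying_not_linear_bound[OF tendsto_powr_one_minus_exp[OF \<Psi>_lim xi(1), of 1] xi(2)] D by auto
    qed
    then show ?thesis using A by (auto simp: case_A_def)
  next
    assume "case_C M \<nu> c \<gamma> S X"
    then have "(\<integral>\<^sup>+x. ennreal (min (x\<^sup>2) x) \<partial>\<nu>) < \<infinity>" by (simp add: case_C_def)
    then obtain C where "\<And>r. r \<ge> 0 \<Longrightarrow> (\<integral>x. 1 - exp (- r * x) - r * x * h x \<partial>\<nu>) \<le> C * r"
      using levy_khintchine_integral_linear_bound[OF SP(2,3)] by blast
    then have "\<forall>\<^sub>F r in at_right 0. laplace_exponent M S r \<le> C * r"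
      by (auto simp: eventually_at_filter S_exponent)
    then show ?thesis using not_linear by blast
  qed (auto simp: case_B_def)
  define Y where "Y = (\<lambda>t \<omega>. c * t + Z t \<omega>)"
  have X_eq: "X t \<omega> = Y t \<omega> - S t \<omega>" for t \<omega>
    using subordinator by (simp add: X_def total_process_def Y_def)
  have Y_meas: "Y t \<in> borel_measurable M" if "t \<ge> 0" for t
    unfolding Y_def using meas[OF that] by measurable
  have Y0: "AE \<omega> in M. \<forall>t\<ge>0. 0 \<le> Y t \<omega>"
    using Z0 by eventually_elim (use c in \<open>simp add: Y_def\<close>)
  have Y_tail: "((\<lambda>u. u powr \<xi> * prob {\<omega>\<in>space M. a * u < Y t \<omega>}) \<longlongrightarrow> 0) at_top" if t: "t \<ge> 0" and a: "a > 0" for t a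
  proof -
    have Zt: "AE \<omega> in M. 0 \<le> Z t \<omega>" using Z0 by eventually_elim (use t in simp)
    have Yt: "AE \<omega> in M. 0 \<le> Y t \<omega>" using Y0 by eventually_elim (use t in simp)
    obtain C where C: "\<forall>\<^sub>F r in at_right 0. 1 - expectation (\<lambda>\<omega>. exp (- r * Z t \<omega>)) \<le> C * r"
      using Z_rational(2)[OF t] by auto
    moreover have "\<forall>\<^sub>F r in at_right (0::real). r > 0" by (auto simp: eventually_at_filter)
    \<comment> \<open>The drift multiplies the transform by \<open>exp (- r * (c * t))\<close>, at
      least \<open>1 - r * (c * t)\<close>; as the transform of \<open>Z t\<close> is at most 1,
      this loses at most \<open>c * t * r\<close>.\<close>
    ultimately have "\<forall>\<^sub>F r in at_right 0. 1 - expectation (\<lambda>\<omega>. exp (- r * Y t \<omega>)) \<le> (C + c * t) * r"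
    proof eventually_elim
      case (elim r)
      have ct: "0 \<le> c * t" using c t by simp
      define E where "E = expectation (\<lambda>\<omega>. exp (- r * Z t \<omega>))"
      have int: "integrable M (\<lambda>\<omega>. exp (- r * Z t \<omega>))"
        using elim t by (intro integrable_exp_uminus meas Zt) auto
      have "E \<le> expectation (\<lambda>\<omega>. 1)"
        unfolding E_def using Zt elim by (intro integral_mono_AE int) auto
      moreover have "0 \<le> E" unfolding E_def by (intro integral_nonneg_AE) auto
      ultimately have E: "0 \<le> E" "E \<le> 1" by (auto simp: prob_space)
      have "expectation (\<lambda>\<omega>. exp (- r * Y t \<omega>)) = exp (- r * (c * t)) * E"
        by (simp only: Y_def E_def distrib_left exp_add integral_mult_right_zero)
      moreover have "exp (- r * (c * t)) * E \<ge> (1 - r * (c * t)) * E"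
        using E exp_ge_add_one_self[of "- r * (c * t)"] by (intro mult_right_mono) auto
      moreover have "(r * (c * t)) * E \<le> (r * (c * t)) * 1"
        using E elim ct by (intro mult_left_mono) auto
      ultimately have "1 - expectation (\<lambda>\<omega>. exp (- r * Y t \<omega>)) \<le> (1 - E) + r * (c * t)"
        by (simp add: left_diff_distrib)
      then show ?case using elim by (simp add: E_def algebra_simps)
    qed
    then show ?thesis
      by (rule tail_negligible_of_linear_laplace_bound[OF Y_meas[OF t] Yt _ xi(2) a])
  qed
  have mono: "AE \<omega> in M. mono_on {0..} (\<lambda>t. S t \<omega>)"
    using subordinator by (simp add: driftless_subordinator_def)
  have S0: "AE \<omega> in M. 0 \<le> S t \<omega>" if t: "t \<ge> 0" for t
  proof -
    have "AE \<omega> in M. S 0 \<omega> = 0" using SP(1) by (simp add: levy_process_def)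
    with mono show ?thesis
      by eventually_elim (use t in \<open>auto dest: monotone_onD[where x=0 and y=t]\<close>)
  qed
  note S_laplace = levy_laplace_transform[OF SP(1) S0]
  have S_tail: "((\<lambda>u. u powr \<xi> * prob {\<omega>\<in>space M. u < S t \<omega>}) \<longlongrightarrow> t * D / Gamma (1 - \<xi>)) at_top"
    if t: "t \<ge> 0" for t
  proof (rule tail_tendsto_of_laplace_transform[OF meas(3)[OF t] S0[OF t] xi(2)])
    have "\<forall>\<^sub>F r in at_right 0. r powr (- \<xi>) * (1 - exp (- t * laplace_exponent M S r))
        = r powr (- \<xi>) * (1 - expectation (\<lambda>\<omega>. exp (- r * S t \<omega>)))"
      unfolding eventually_at_filter by (intro always_eventually allI impI, subst S_laplace) (use t in auto)
    then show "((\<lambda>r. r powr (- \<xi>) * (1 - expectation (\<lambda>\<omega>. exp (- r * S t \<omega>)))) \<longlongrightarrow> t * D) (at_right 0)"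
      by (rule Lim_transform_eventually[OF tendsto_powr_one_minus_exp[OF \<Psi>_lim xi(1)]])
  qed (use t D in simp)
  note fixed_time = running_inf_tail_at_fixed_time[OF X_meas X_paths meas(3) mono Y_meas Y0 X_eq _ S_tail Y_tail]
  \<comment> \<open>\<open>D + 1\<close> eventually bounds \<open>u powr \<xi>\<close> times the
    exponent at \<open>1 / u\<close>; the denominator comes from
    \<open>tail_le_laplace_transform\<close>.\<close>
  define K where "K = (D + 1) / (1 - exp (- 1))"
  have "((\<lambda>u. inverse u powr (- \<xi>) * laplace_exponent M S (inverse u)) \<longlongrightarrow> D) at_top"
    using \<Psi>_lim unfolding filterlim_at_right_to_top .
  then have "\<forall>\<^sub>F u in at_top. inverse u powr (- \<xi>) * laplace_exponent M S (inverse u) < D + 1"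
    by (rule order_tendstoD) simp
  then have bound: "\<forall>\<^sub>F u in at_top. \<forall>t\<ge>0. u powr \<xi> * prob {\<omega>\<in>space M. running_inf X t \<omega> < - u} \<le> K * t"
    using eventually_gt_at_top[of 0]
  proof eventually_elim
    case (elim u)
    show ?case
    proof (intro allI impI)
      fix t :: real assume t: "t \<ge> 0"
      define y where "y = laplace_exponent M S (1 / u)"
      have "prob {\<omega>\<in>space M. running_inf X t \<omega> < - u} \<le> prob {\<omega>\<in>space M. u < S t \<omega>}"
        using fixed_time(1)[OF _ _ _ _ _ t] t by auto
      also have "\<dots> \<le> (1 - expectation (\<lambda>\<omega>. exp (- (1 / u) * S t \<omega>))) / (1 - exp (- 1))"
        using elim t by (intro tail_le_laplace_transform meas S0) auto
      also have "\<dots> = (1 - exp (- t * y)) / (1 - exp (- 1))"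
        using elim t unfolding y_def by (subst S_laplace) auto
      \<comment> \<open>Here the bound becomes linear in \<open>t\<close>, with the condition on
        \<open>u\<close> involving only \<open>y\<close> and not \<open>t\<close>.\<close>
      also have "\<dots> \<le> (t * y) / (1 - exp (- 1))"
        using exp_ge_add_one_self[of "- t * y"] by (intro divide_right_mono) auto
      finally have "u powr \<xi> * prob {\<omega>\<in>space M. running_inf X t \<omega> < - u} \<le> u powr \<xi> * ((t * y) / (1 - exp (- 1)))"
        by (intro mult_left_mono) auto
      also have "\<dots> = t * (u powr \<xi> * y) / (1 - exp (- 1))" by simp
      also have "\<dots> \<le> t * (D + 1) / (1 - exp (- 1))"
      proof (intro divide_right_mono mult_left_mono t)
        show "u powr \<xi> * y \<le> D + 1"
          using elim by (simp add: y_def powr_minus inverse_powr inverse_eq_divide[symmetric])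
      qed simp
      finally show "u powr \<xi> * prob {\<omega>\<in>space M. running_inf X t \<omega> < - u} \<le> K * t"
        by (simp add: K_def mult.commute)
    qed
  qed
  have lim: "((\<lambda>u. u powr \<xi> * prob {\<omega>\<in>space M. running_inf X t \<omega> < - u}) \<longlongrightarrow> t * (D / Gamma (1 - \<xi>))) at_top"
    if t: "t \<ge> 0" for t
    using fixed_time(2)[OF _ _ _ _ _ t] t by auto
  have "((\<lambda>u. u powr \<xi> * prob {\<omega>\<in>space M. running_inf X (e \<omega>) \<omega> < - u}) \<longlongrightarrow> D / Gamma (1 - \<xi>) / q) at_top"
    by (rule running_inf_tail_at_exponential_time[OF X_meas X_paths _ _ q lim bound]) (assumption | fact)+
  then show ?thesis by (simp add: powr_minus divide_inverse mult.commute mult.left_commute)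
qed

end
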